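(* Let $\{S_n\}_{n\ge 0}$ be a random walk such that $\mathbf P(S_n\ge 0)\to\rho$ as $n\to\infty$ for some $\rho\in(0,1)$. Let $g:[0,\infty)\to(0,\infty)$ be an increasing function such that the function $x\mapsto h(g(x))$ is subadditive on $[0,\infty)$. If $$\mathbf E\,h(g(T_0))<\infty,$$ then there exists a constant $V(g)\in(0,\infty)$ such that $$\mathbf P(T_g>n)\sim V(g)\,\mathbf P(T_0>n)\sim V(g)\,n^{\rho-1}L(n),\qquad n\to\infty,$$ where $L$ is the slowly varying function with $\mathbf P(T_0>n)\sim n^{\rho-1}L(n)$.
   Context: Random walk: $S_0=0$, $S_n=X_1+\dots+X_n$ for $n\ge1$, where $X,X_1,X_2,\dots$ are i.i.d. real random variables. For a function $g$, $T_g:=\min\{n\ge1: S_n<-g(n)\}$ (with $\min\emptyset=\infty$), and $T_0:=\min\{n\ge1:S_n<0\}$ is the first strict descending ladder epoch. The function $h$ is the renewal function of the strict decreasing ladder height process, normalized by $h(0)=1$: if $\chi_1,\chi_2,\dots$ are i.i.d. copies of $-S_{T_0}$, then $h(x)=1+\sum_{k\ge1}\mathbf P(\chi_1+\dots+\chi_k\le x)$ for $x\ge0$; equivalently, $h(x)=\mathbf E\min\{k\ge1:\chi_1+\dots+\chi_k>x\}$. It is well known that when $\mathbf P(S_n\ge0)\to\rho\in(0,1)$ one has $\mathbf P(T_0>n)\sim n^{\rho-1}L(n)$ for some slowly varying function $L$. "Increasing" is meant in the non-strict sense. A function $f$ is subadditive if $f(x+y)\le f(x)+f(y)$ for all $x,y\ge0$.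 $a(n)\sim b(n)$ means $a(n)/b(n)\to1$. *)

theory Defs
  imports "HOL-Probability.Probability" "HOL-Library.Landau_Symbols"
begin

definition walk :: "(nat \<Rightarrow> 'a \<Rightarrow> real) \<Rightarrow> nat \<Rightarrow> 'a \<Rightarrow> real" where
  "walk X n \<omega> = (\<Sum>i<n. X i \<omega>)"

(* The infimum in enat of a nonempty set is attained, and the infimum of the empty set is \<infinity>. *)
definition passage_time :: "(nat \<Rightarrow> 'a \<Rightarrow> real) \<Rightarrow> (real \<Rightarrow> real) \<Rightarrow> 'a \<Rightarrow> enat" where
  "passage_time S g \<omega> = Inf (enat ` {n. 1 \<le> n \<and> S n \<omega> < - g (real n)})"

abbreviation ladder_epoch :: "(nat \<Rightarrow> 'a \<Rightarrow> real) \<Rightarrow> 'a \<Rightarrow> enat" where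
  "ladder_epoch S \<equiv> passage_time S (\<lambda>_. 0)"

(* - S_{T_0}. The value on {T_0 = \<infinity>} is a convention: that event is null whenever
   P(S_n \<ge> 0) has a limit strictly below 1. *)
definition ladder_height :: "(nat \<Rightarrow> 'a \<Rightarrow> real) \<Rightarrow> 'a \<Rightarrow> real" where
  "ladder_height S \<omega> = (case ladder_epoch S \<omega> of enat n \<Rightarrow> - S n \<omega> | \<infinity> \<Rightarrow> 0)"

(* h(x) = 1 + sum over k \<ge> 1 of P(chi_1 + ... + chi_k \<le> x), for x \<ge> 0. The i.i.d. copies chi_i of
   - S_{T_0} are the coordinates of the infinite product of its law, numbered from 0.
   Values are in ennreal so that the series needs no summability side condition. *)
definition renewal_fun :: "'a measure \<Rightarrow> (nat \<Rightarrow> 'a \<Rightarrow> real) \<Rightarrow> real \<Rightarrow> ennreal" where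
  "renewal_fun M S x =
     (let P = Pi\<^sub>M (UNIV :: nat set) (\<lambda>_. distr M borel (ladder_height S))
      in 1 + (\<Sum>k. emeasure P {c \<in> space P. (\<Sum>i\<le>k. c i) \<le> x}))"

definition slowly_varying :: "(real \<Rightarrow> real) \<Rightarrow> bool" where
  "slowly_varying L \<longleftrightarrow>
     L \<in> borel_measurable (restrict_space borel {0<..}) \<and>
     (\<forall>x>0. L x > 0) \<and>
     (\<forall>c>0. ((\<lambda>x. L (c * x) / L x) \<longlongrightarrow> 1) at_top)"

end

(*
  Write a n = P(T_0 > n), A n = a 0 + ... + a (n - 1), and call n a record if S_n < S_j for all j < n
  (so 0 is a record).

  Regular variation of a. Rotating the increments at the first minimum of S_1, ..., S_n gives
  P(S_n < 0) = sum over i < n of P(n record, T_0 > i). Together with the decompositions at the first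
  and at the last record this yields n a n = sum over 1 <= k <= n of P(S_k >= 0) a (n - k), hence
  n a n / A n -> rho. This already forces A and a to be regularly varying; no Tauberian theorem is
  needed.

  The boundary. As g increases, T_g is a record epoch. With w j = P(j record, T_g > j) the last record
  before n gives P(T_g > n) = sum over j <= n of w j a (n - j), so monotonicity reduces the claim to
  V = sum of all w j < infinity. Put W n = w 0 + ... + w n. Summing the convolution gives
  n P(T_g > n) <= W n A n, that is P(T_g > n) <= C W n a n. The expected number of records after n whose
  depth is at most x, on {T_g > n}, is at most P(T_g > n) h(x); with x = g(2 n) this shows
  W (2 n) <= W n (1 + C a n h(g(2 n))). By subadditivity h(g(2 n)) <= 2 h(g(n)), and E h(g(T_0)) finite
  makes the sum of a (2^i) h(g(2^i)) finite, so W is bounded.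
*)

theory Submission
  imports Defs
begin

text \<open>The obstacle is circularity: the weights \<open>w j\<close> involve the very event
  \<open>T_g > j\<close> that is to be estimated, so nothing bounds their sum beforehand. The crude
  estimate \<open>P(T_g > n) \<le> C W n a n\<close> is nevertheless linear in \<open>W n\<close>,
  and so each doubling of \<open>n\<close> multiplies \<open>W\<close> by a factor whose excess over
  1 is summable along powers of 2. That scale suits the moment condition: as
  \<open>\<rho> < 1\<close>, \<open>a (2 n) / a n\<close> stays below a constant less than 1, hence
  \<open>P(2^i < T_0 \<le> 2^(i+1))\<close> is comparable to \<open>a (2^i)\<close>. Summability of
  \<open>w\<close> does not by itself give the limit, since \<open>w j\<close> with \<open>j\<close>
  close to \<open>n\<close> meets the large values of \<open>a\<close>. Monotonicity of
  \<open>P(T_g > n)\<close> permits averaging over a window proportional to \<open>n\<close>, where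
  \<open>A n = O(n a n)\<close> makes those terms harmless. Records serve as the basic notion
  because being a record is decided by finitely many increments.\<close>

section \<open>Asymptotics of real sequences\<close>

text \<open>With generating functions \<open>A\<close>, \<open>B\<close>, \<open>U\<close> and \<open>D\<close> of \<open>a\<close>, \<open>b\<close>, \<open>u\<close> and \<open>k (a (k - 1) - a k)\<close>, the first
  hypothesis is \<open>(1 - X) U A = 1\<close>, the other two say \<open>(1 - X) B = X - (1 - X) D U\<close>, and the
  conclusion is the logarithmic derivative \<open>X A' = A B\<close> of Spitzer's identity.\<close>

lemma spitzer_convolution:
  fixes a b c u :: "nat \<Rightarrow> real"
  assumes ua: "\<And>n. (\<Sum>j\<le>n. u j * a (n - j)) = 1"
    and bc: "\<And>n. 1 \<le> n \<Longrightarrow> b n + c n = 1"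
    and c: "\<And>n. 1 \<le> n \<Longrightarrow> c n = (\<Sum>i<n. \<Sum>k\<in>{i<..n}. (a (k - 1) - a k) * u (n - k))"
  shows "real n * a n = (\<Sum>k=1..n. b k * a (n - k))"
proof -
  define A U B D C where "A = Abs_fps a" and "U = Abs_fps u"
    and "B = Abs_fps (\<lambda>n. if n = 0 then 0 else b n)"
    and "D = Abs_fps (\<lambda>k. real k * (a (k - 1) - a k))"
    and "C = Abs_fps (\<lambda>n. if n = 0 then 0 else c n)"
  have UA: "U * A = Abs_fps (\<lambda>_. 1)"
    by (rule fps_ext) (simp add: fps_mult_nth U_def A_def atLeast0AtMost ua)
  have geo: "(1 - fps_X) * Abs_fps (\<lambda>_. 1 :: real) = 1"
    by (rule fps_ext) (simp add: algebra_simps)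
  have CD: "C = D * U"
  proof (rule fps_ext)
    fix n
    show "fps_nth C n = fps_nth (D * U) n"
    proof (cases "n = 0")
      case False
      have inner: "(\<Sum>k\<in>{i<..n}. f k) = (\<Sum>k\<in>{1..n}. if i < k then f k else 0)"
        for i and f :: "nat \<Rightarrow> real"
        by (intro sum.mono_neutral_cong_left) auto
      have "c n = (\<Sum>i<n. \<Sum>k\<in>{1..n}. if i < k then (a (k - 1) - a k) * u (n - k) else 0)"
        using False c[of n] by (simp only: inner)
      also have "\<dots> = (\<Sum>k\<in>{1..n}. \<Sum>i<n. if i < k then (a (k - 1) - a k) * u (n - k) else 0)"
        by (rule sum.swap)
      \<comment> \<open>The summand does not depend on \<open>i\<close>, which ranges over the
        \<open>k\<close> numbers below \<open>k\<close>; this is the source of the factor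
        \<open>real k\<close> in \<open>D\<close>.\<close>
      also have "\<dots> = (\<Sum>k\<in>{1..n}. real k * (a (k - 1) - a k) * u (n - k))"
      proof (rule sum.cong[OF refl])
        fix k assume k: "k \<in> {1..n}"
        have "(\<Sum>i<n. if i < k then (a (k - 1) - a k) * u (n - k) else 0) =
            (\<Sum>i<k. (a (k - 1) - a k) * u (n - k))"
          using k by (intro sum.mono_neutral_cong_right) auto
        then show "(\<Sum>i<n. if i < k then (a (k - 1) - a k) * u (n - k) else 0) =
            real k * (a (k - 1) - a k) * u (n - k)" by simp
      qed
      also have "\<dots> = (\<Sum>k\<in>{0..n}. real k * (a (k - 1) - a k) * u (n - k))"
        by (intro sum.mono_neutral_left) auto
      finally show ?thesis using False by (simp add: C_def D_def U_def fps_mult_nth)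
    qed (simp add: C_def D_def U_def)
  qed
  have BC: "(1 - fps_X) * B = fps_X - (1 - fps_X) * C"
  proof -
    have "B + C = Abs_fps (\<lambda>_. 1) - 1"
      by (rule fps_ext) (use bc in \<open>auto simp: B_def C_def\<close>)
    then have "(1 - fps_X) * (B + C) = 1 - (1 - fps_X)"
      using geo by (simp only: right_diff_distrib mult_1_right)
    then show ?thesis by (simp add: algebra_simps)
  qed
  have D: "fps_X * fps_deriv ((1 - fps_X) * A) = - D"
  proof (rule fps_ext)
    fix n
    show "fps_nth (fps_X * fps_deriv ((1 - fps_X) * A)) n = fps_nth (- D) n"
      by (cases n) (simp_all add: A_def D_def algebra_simps)
  qed
  have AU: "A * ((1 - fps_X) * U) = 1"
  proof -
    have "A * ((1 - fps_X) * U) = (1 - fps_X) * (U * A)" by (simp only: ac_simps)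
    then show ?thesis by (simp only: UA geo)
  qed
  \<comment> \<open>Since \<open>A (1 - X) U = 1\<close>, multiplying \<open>BC\<close> by
    \<open>A\<close> leaves \<open>X A - D\<close>. By the product rule
    \<open>- D = X ((1 - X) A)'\<close> equals \<open>- X A + (1 - X) X A'\<close>, and the terms
    \<open>X A\<close> cancel.\<close>
  have "(1 - fps_X) * (A * B) = A * ((1 - fps_X) * B)"
    by (simp add: mult.left_commute)
  also have "\<dots> = A * fps_X - A * ((1 - fps_X) * (D * U))"
    unfolding BC CD by (rule right_diff_distrib)
  also have "A * ((1 - fps_X) * (D * U)) = D * (A * ((1 - fps_X) * U))"
    by (simp only: ac_simps)
  also have "\<dots> = - (fps_X * fps_deriv ((1 - fps_X) * A))"
    by (simp only: AU D) simp
  also have "A * fps_X - - (fps_X * fps_deriv ((1 - fps_X) * A)) = (1 - fps_X) * (fps_X * fps_deriv A)"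
    by (simp add: algebra_simps)
  finally have "(1 - fps_X) * (A * B) = (1 - fps_X) * (fps_X * fps_deriv A)" .
  moreover have "1 - fps_X \<noteq> (0 :: real fps)"
  proof
    assume "1 - fps_X = (0 :: real fps)"
    then have "fps_nth (1 - fps_X :: real fps) 0 = fps_nth 0 0" by simp
    then show False by simp
  qed
  ultimately have eq: "A * B = fps_X * fps_deriv A" by simp
  have "real n * a n = fps_nth (fps_X * fps_deriv A) n"
    by (cases n) (simp_all add: A_def algebra_simps)
  also have "\<dots> = fps_nth (B * A) n" by (simp add: eq[symmetric] mult.commute)
  also have "\<dots> = (\<Sum>k=0..n. (if k = 0 then 0 else b k) * a (n - k))"
    by (simp add: fps_mult_nth A_def B_def)
  also have "\<dots> = (\<Sum>k=1..n. b k * a (n - k))"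
    by (intro sum.mono_neutral_cong_right) auto
  finally show ?thesis .
qed

text \<open>The quotient is an average of \<open>b 1, ..., b n\<close> with weights
  \<open>a (n - k) / A n\<close>, each at most \<open>1 / A n\<close>. It inherits the limit of
  \<open>b\<close> once \<open>A\<close> diverges, and divergence follows from the single term
  \<open>k = n\<close>: it gives \<open>a n \<ge> b n / n\<close>, to be compared with the harmonic
  series.\<close>

lemma convolution_ratio:
  fixes a b :: "nat \<Rightarrow> real"
  assumes rec: "\<And>n. real n * a n = (\<Sum>k=1..n. b k * a (n - k))"
    and a0: "a 0 = 1" and a: "decseq a" "\<And>n. 0 \<le> a n"
    and b: "\<And>n. 0 \<le> b n" "\<And>n. b n \<le> 1" "b \<longlonglongrightarrow> \<rho>" and \<rho>: "0 < \<rho>" "\<rho> < 1"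
  shows "\<And>n. 0 < a n"
    "(\<lambda>n. real n * a n / (\<Sum>k<n. a k)) \<longlonglongrightarrow> \<rho>"
proof -
  have ge: "b n \<le> real n * a n" if "1 \<le> n" for n
  proof -
    have "b n * a (n - n) \<le> (\<Sum>k=1..n. b k * a (n - k))"
      using that by (intro member_le_sum) (auto intro!: mult_nonneg_nonneg a b)
    then show ?thesis using rec[of n] a0 by simp
  qed
  have ev: "\<forall>\<^sub>F n in sequentially. \<rho> / 2 < b n"
    using b(3) \<rho> by (intro order_tendstoD) auto
  have ev2: "\<forall>\<^sub>F n in sequentially. \<rho> / 2 / real n \<le> a n \<and> 1 \<le> n"
    using ev eventually_ge_at_top[of 1]
  proof eventually_elim
    case (elim n)
    then have "\<rho> / 2 \<le> real n * a n" using ge[of n] by simp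
    with elim show ?case by (simp add: field_simps)
  qed
  then obtain N where N: "\<And>n. N \<le> n \<Longrightarrow> \<rho> / 2 / real n \<le> a n \<and> 1 \<le> n"
    unfolding eventually_sequentially by blast
  show pos: "0 < a n" for n
  proof -
    have "0 < \<rho> / 2 / real (max N n)" using N[of "max N n"] \<rho> by simp
    also have "\<dots> \<le> a (max N n)" using N[of "max N n"] by simp
    also have "\<dots> \<le> a n" by (rule decseqD[OF a(1)]) simp
    finally show ?thesis .
  qed
  define A where "A n = (\<Sum>k<n. a k)" for n
  have "\<not> summable a"
  proof
    assume "summable a"
    then have "summable (\<lambda>n. \<rho> / 2 / real n)"
      by (rule summable_comparison_test_ev[rotated])
        (use ev2 \<rho> in \<open>auto elim!: eventually_mono\<close>)
    then have "summable (\<lambda>n. 2 / \<rho> * (\<rho> / 2 / real n))" by (rule summable_mult)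
    then have "summable (\<lambda>n. 1 / real n)" using \<rho> by simp
    then show False using not_summable_harmonic[where 'a=real] by (simp add: inverse_eq_divide)
  qed
  have A_mono: "mono A" unfolding A_def by (intro monoI sum_mono2) (auto intro: a)
  have Ainf: "\<forall>\<^sub>F n in sequentially. Z \<le> A n" for Z
  proof -
    have "\<exists>n. Z \<le> A n"
    proof (rule ccontr)
      assume "\<not> ?thesis"
      then have "summable a"
        by (intro summableI_nonneg_bounded[of a Z])
          (auto simp: A_def not_le intro: a less_imp_le)
      with \<open>\<not> summable a\<close> show False by simp
    qed
    then obtain n where "Z \<le> A n" by blast
    then show "\<forall>\<^sub>F n in sequentially. Z \<le> A n"
      using monoD[OF A_mono] unfolding eventually_sequentially by (meson order_trans)
  qed
  show "(\<lambda>n. real n * a n / (\<Sum>k<n. a k)) \<longlonglongrightarrow> \<rho>"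
    unfolding A_def[symmetric]
  proof (rule LIMSEQ_I)
    fix r :: real assume r: "0 < r"
    from LIMSEQ_D[OF b(3) half_gt_zero[OF r]] obtain K
      where K: "\<And>k. K \<le> k \<Longrightarrow> \<bar>b k - \<rho>\<bar> < r / 2" by auto
    have bound: "\<bar>real n * a n - \<rho> * A n\<bar> \<le> r / 2 * A n + real K" for n
    proof -
      have A': "A n = (\<Sum>k=1..n. a (n - k))" unfolding A_def
        by (rule sum.reindex_bij_witness[of _ "\<lambda>k. n - k" "\<lambda>k. n - k"]) auto
      have a1: "a k \<le> 1" for k using decseqD[OF a(1), of 0 k] a0 by simp
      have "\<bar>real n * a n - \<rho> * A n\<bar> = \<bar>\<Sum>k=1..n. (b k - \<rho>) * a (n - k)\<bar>"
        unfolding rec A' by (simp add: sum_distrib_left sum_subtractf algebra_simps)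
      also have "\<dots> \<le> (\<Sum>k=1..n. \<bar>(b k - \<rho>) * a (n - k)\<bar>)" by (rule sum_abs)
      \<comment> \<open>An index below \<open>K\<close> costs at most 1, because \<open>a\<close> is
        at most 1 and both \<open>b k\<close> and \<open>\<rho>\<close> lie in
        \<open>[0, 1]\<close>; together these indices cost at most \<open>real K\<close>.\<close>
      also have "\<dots> \<le> (\<Sum>k=1..n. r / 2 * a (n - k) + (if k < K then 1 else 0))"
      proof (rule sum_mono)
        fix k
        have "\<bar>b k - \<rho>\<bar> \<le> 1" using b(1,2)[of k] \<rho> by (auto simp: abs_le_iff)
        then have "\<bar>b k - \<rho>\<bar> * a (n - k) \<le> 1 * 1"
          by (intro mult_mono) (use a a1 in auto)
        moreover have "\<bar>b k - \<rho>\<bar> * a (n - k) \<le> r / 2 * a (n - k)" if "K \<le> k"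
          using K[OF that] by (intro mult_right_mono) (auto intro: a)
        moreover have "0 \<le> r / 2 * a (n - k)" using r a(2) by simp
        ultimately show "\<bar>(b k - \<rho>) * a (n - k)\<bar> \<le> r / 2 * a (n - k) + (if k < K then 1 else 0)"
          using a(2)[of "n - k"] unfolding abs_mult by (simp add: not_less)
      qed
      also have "\<dots> = r / 2 * A n + (\<Sum>k=1..n. if k < K then 1 else 0)"
        unfolding A' by (simp only: sum.distrib sum_distrib_left)
      also have "(\<Sum>k=1..n. if k < K then 1 else 0) \<le> (\<Sum>k<K. 1 :: real)"
        by (subst sum.inter_filter[symmetric]) (use card_mono[of "{..<K}" "{k \<in> {1..n}. k < K}"] in \<open>auto simp: sum.If_cases\<close>)
      finally show ?thesis by simp
    qed
    obtain N where N: "\<And>n. N \<le> n \<Longrightarrow> 2 * real K / r + 1 \<le> A n"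
      using Ainf[of "2 * real K / r + 1"] unfolding eventually_sequentially by blast
    show "\<exists>N. \<forall>n\<ge>N. norm (real n * a n / A n - \<rho>) < r"
    proof (intro exI allI impI)
      fix n assume n: "N \<le> n"
      have Kr: "0 \<le> 2 * real K / r" using r by simp
      then have A0: "0 < A n" using N[OF n] by linarith
      have "real K < r / 2 * A n" using N[OF n] r by (simp add: field_simps)
      then have "\<bar>real n * a n - \<rho> * A n\<bar> < r * A n" using bound[of n] by linarith
      moreover have "real n * a n / A n - \<rho> = (real n * a n - \<rho> * A n) / A n"
        using A0 by (simp add: field_simps)
      ultimately show "norm (real n * a n / A n - \<rho>) < r"
        using A0 by (simp add: pos_divide_less_eq)
    qed
  qed
qed

text \<open>\<open>a n / A n\<close> is a discrete logarithmic derivative of \<open>A\<close>, so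
  \<open>ln (A n)\<close> increases like \<open>\<rho> ln n\<close> with errors
  \<open>o(1 / n)\<close> per step, which add up to \<open>o(1)\<close> between indices of bounded
  ratio. The conclusion is slow variation of \<open>a n * n powr (1 - \<rho>)\<close>, uniform over
  ratios in \<open>[1 / K, K]\<close>; interpolation between integers needs this uniformity.\<close>

lemma regular_variation_of_ratio:
  fixes a :: "nat \<Rightarrow> real"
  assumes a: "\<And>n. 0 < a n" and \<rho>: "0 < \<rho>"
    and lim: "(\<lambda>n. real n * a n / (\<Sum>k<n. a k)) \<longlonglongrightarrow> \<rho>" and K: "0 < K" and e: "0 < e"
  shows "\<exists>N. \<forall>m\<ge>N. \<forall>n\<ge>N. real m \<le> K * real n \<longrightarrow> real n \<le> K * real m \<longrightarrow>
    \<bar>ln (a m * real m powr (1 - \<rho>)) - ln (a n * real n powr (1 - \<rho>))\<bar> \<le> e"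
proof -
  define A where "A n = (\<Sum>k<n. a k)" for n
  (* The quotient hypothesis makes D vary slowly: n (D (n + 1) - D n) tends to 0. *)
  define D where "D n = ln (A n) - \<rho> * ln (real n)" for n
  have A_pos: "0 < A n" if "1 \<le> n" for n
    unfolding A_def using that a by (intro sum_pos) (auto simp: lessThan_empty_iff)
  have lim: "(\<lambda>n. real n * a n / A n) \<longlonglongrightarrow> \<rho>" using lim by (simp add: A_def)
  have lim0: "(\<lambda>n. a n / A n) \<longlonglongrightarrow> 0"
  proof -
    have "(\<lambda>n. (real n * a n / A n) * (1 / real n)) \<longlonglongrightarrow> \<rho> * 0"
      by (intro tendsto_mult lim lim_1_over_n)
    then show ?thesis
      by (simp only: mult_zero_right)
        (erule Lim_transform_eventually, rule eventually_mono[OF eventually_gt_at_top[of 0]], auto)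
  qed
  have step: "(\<lambda>n. real n * (D (Suc n) - D n)) \<longlonglongrightarrow> 0"
  proof -
    have log_lim: "(\<lambda>n. real n * ln (1 + f n)) \<longlonglongrightarrow> l"
      if f: "(\<lambda>n. real n * f n) \<longlonglongrightarrow> l" "f \<longlonglongrightarrow> 0" "\<forall>\<^sub>F n in sequentially. 0 < f n" for f l
    proof (rule tendsto_sandwich[OF _ _ _ f(1)])
      show "\<forall>\<^sub>F n in sequentially. real n * f n / (1 + f n) \<le> real n * ln (1 + f n)"
        using f(3)
      proof eventually_elim
        case (elim n)
        have "ln (1 / (1 + f n)) \<le> 1 / (1 + f n) - 1" using elim by (intro ln_le_minus_one) simp
        moreover have "1 / (1 + f n) - 1 = - (f n / (1 + f n))" using elim by (simp add: field_simps)
        ultimately have "f n / (1 + f n) \<le> ln (1 + f n)" using elim by (simp add: ln_div)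
        then have "real n * (f n / (1 + f n)) \<le> real n * ln (1 + f n)" by (intro mult_left_mono) auto
        then show ?case by simp
      qed
      show "\<forall>\<^sub>F n in sequentially. real n * ln (1 + f n) \<le> real n * f n"
        using f(3)
        by eventually_elim (intro mult_left_mono ln_add_one_self_le_self, auto)
      have "(\<lambda>n. real n * f n / (1 + f n)) \<longlonglongrightarrow> l / (1 + 0)"
        by (intro tendsto_intros f) simp
      then show "(\<lambda>n. real n * f n / (1 + f n)) \<longlonglongrightarrow> l" by simp
    qed
    have 1: "(\<lambda>n. real n * ln (1 + a n / A n)) \<longlonglongrightarrow> \<rho>"
      by (rule log_lim) (use lim lim0 a A_pos in \<open>auto intro!: eventually_sequentiallyI[of 1] divide_pos_pos\<close>)
    have 2: "(\<lambda>n. real n * ln (1 + 1 / real n)) \<longlonglongrightarrow> 1"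
    proof (rule log_lim)
      show "(\<lambda>n. real n * (1 / real n)) \<longlonglongrightarrow> 1"
        by (rule Lim_transform_eventually[OF tendsto_const eventually_mono[OF eventually_gt_at_top[of 0]]]) auto
    qed (auto intro: lim_1_over_n eventually_sequentiallyI[of 1])
    have "(\<lambda>n. real n * ln (1 + a n / A n) - \<rho> * (real n * ln (1 + 1 / real n))) \<longlonglongrightarrow> \<rho> - \<rho> * 1"
      by (intro tendsto_intros 1 2)
    then have "(\<lambda>n. real n * ln (1 + a n / A n) - \<rho> * (real n * ln (1 + 1 / real n))) \<longlonglongrightarrow> 0" by simp
    then show ?thesis
    proof (rule Lim_transform_eventually)
      show "\<forall>\<^sub>F n in sequentially. real n * ln (1 + a n / A n) - \<rho> * (real n * ln (1 + 1 / real n)) =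
          real n * (D (Suc n) - D n)"
        using eventually_ge_at_top[of 1]
      proof eventually_elim
        case (elim n)
        have "1 + a n / A n = A (Suc n) / A n" "1 + 1 / real n = real (Suc n) / real n"
          using elim A_pos[of n] by (auto simp: A_def field_simps)
        then have "ln (1 + a n / A n) = ln (A (Suc n)) - ln (A n)"
          "ln (1 + 1 / real n) = ln (real (Suc n)) - ln (real n)"
          using elim A_pos[of n] A_pos[of "Suc n"] by (auto simp: ln_div)
        then show ?case by (simp only: D_def) (simp add: algebra_simps)
      qed
    qed
  qed
  \<comment> \<open>At most \<open>K * n\<close> steps of size \<open>\<eta> / n\<close> cost
    \<open>e / 2\<close> for \<open>D\<close>; the passage from \<open>A\<close> to \<open>a\<close>
    costs \<open>e / 4\<close> at each of the two indices.\<close>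
  define \<eta> where "\<eta> = e / (2 * K)"
  have "0 < \<eta>" using e K by (simp add: \<eta>_def)
  then obtain N1 where N1: "\<And>n. N1 \<le> n \<Longrightarrow> \<bar>real n * (D (Suc n) - D n)\<bar> < \<eta>"
    using LIMSEQ_D[OF step] by auto
  have "(\<lambda>n. ln (real n * a n / A n)) \<longlonglongrightarrow> ln \<rho>"
    using lim \<rho> by (intro tendsto_ln) auto
  from LIMSEQ_D[OF this, of "e / 4"] e
  obtain N2 where N2: "\<And>n. N2 \<le> n \<Longrightarrow> \<bar>ln (real n * a n / A n) - ln \<rho>\<bar> < e / 4"
    by auto
  have tele: "\<bar>D (n + j) - D n\<bar> \<le> \<eta> * real j / real n" if "N1 \<le> n" "1 \<le> n" for n j
  proof (induction j)
    case (Suc j)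
    have "\<bar>D (Suc (n + j)) - D (n + j)\<bar> = \<bar>real (n + j) * (D (Suc (n + j)) - D (n + j))\<bar> / real (n + j)"
      using that by (simp add: abs_mult)
    also have "\<dots> \<le> \<eta> / real n"
      using N1[of "n + j"] that by (intro frac_le) auto
    finally have "\<bar>D (n + Suc j) - D n\<bar> \<le> \<eta> / real n + \<eta> * real j / real n"
      using Suc by (simp add: abs_le_iff)
    also have "\<dots> = \<eta> * real (Suc j) / real n" by (simp add: add_divide_distrib distrib_left)
    finally show ?case .
  qed simp
  have D_close: "\<bar>D m - D n\<bar> \<le> e / 2" if "N1 \<le> n" "1 \<le> n" "n \<le> m" "real m \<le> K * real n" for m n
  proof -
    have "\<bar>D m - D n\<bar> \<le> \<eta> * real (m - n) / real n" using tele[of n "m - n"] that by simp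
    also have "\<dots> \<le> \<eta> * (K * real n) / real n"
      using that \<open>0 < \<eta>\<close> by (intro divide_right_mono mult_left_mono) auto
    also have "\<dots> = e / 2" using that K by (simp add: \<eta>_def)
    finally show ?thesis .
  qed
  have E: "ln (a n * real n powr (1 - \<rho>)) = ln (real n * a n / A n) + D n" if "1 \<le> n" for n
    using that a[of n] A_pos[of n] by (simp add: D_def ln_mult ln_div ln_powr algebra_simps)
  show ?thesis
  proof (intro exI[of _ "max (max N1 N2) 1"] allI impI)
    fix m n assume m: "max (max N1 N2) 1 \<le> m" and n: "max (max N1 N2) 1 \<le> n"
      and K: "real m \<le> K * real n" "real n \<le> K * real m"
    have "\<bar>D m - D n\<bar> \<le> e / 2"
    proof (cases "n \<le> m")
      case True then show ?thesis using D_close[of n m] m n K by auto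
    next
      case False then show ?thesis using D_close[of m n] m n K by (auto simp: abs_minus_commute)
    qed
    then show "\<bar>ln (a m * real m powr (1 - \<rho>)) - ln (a n * real n powr (1 - \<rho>))\<bar> \<le> e"
    proof -
      have "\<bar>ln (real m * a m / A m) - ln \<rho>\<bar> < e / 4" "\<bar>ln (real n * a n / A n) - ln \<rho>\<bar> < e / 4"
        using N2 m n by auto
      with \<open>\<bar>D m - D n\<bar> \<le> e / 2\<close> show ?thesis
        using E[of m] E[of n] m n by linarith
    qed
  qed
qed

text \<open>The maximum with 1 keeps the function positive on \<open>(0, 1)\<close>, where \<open>l 0\<close> may vanish.\<close>

lemma slowly_varying_interpolation:
  fixes l :: "nat \<Rightarrow> real"
  assumes pos: "\<And>n. 1 \<le> n \<Longrightarrow> 0 < l n"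
    and close: "\<And>K e. 0 < K \<Longrightarrow> 0 < e \<Longrightarrow> \<exists>N. \<forall>m\<ge>N. \<forall>n\<ge>N. real m \<le> K * real n \<longrightarrow>
      real n \<le> K * real m \<longrightarrow> \<bar>ln (l m) - ln (l n)\<bar> \<le> e"
  shows "slowly_varying (\<lambda>x. l (max 1 (nat \<lfloor>x\<rfloor>)))"
  unfolding slowly_varying_def
proof (intro conjI allI impI)
  show "(\<lambda>x::real. l (max 1 (nat \<lfloor>x\<rfloor>))) \<in> borel_measurable (restrict_space borel {0<..})"
    by (intro measurable_restrict_space1) measurable
next
  fix x :: real show "0 < l (max 1 (nat \<lfloor>x\<rfloor>))" by (rule pos) simp
next
  fix c :: real assume c: "0 < c"
  \<comment> \<open>For large \<open>x\<close> rounding loses at most a factor 2, so the floors of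
    \<open>x\<close> and \<open>c * x\<close> are within a factor \<open>K\<close> of each
    other.\<close>
  define K where "K = max (2 * c) (2 / c)"
  have K: "0 < K" using c by (simp add: K_def)
  have "((\<lambda>x. ln (l (max 1 (nat \<lfloor>c * x\<rfloor>))) - ln (l (max 1 (nat \<lfloor>x\<rfloor>)))) \<longlongrightarrow> 0) at_top"
  proof (rule tendstoI)
    fix e :: real assume e: "0 < e"
    obtain N where N: "\<And>m n. N \<le> m \<Longrightarrow> N \<le> n \<Longrightarrow> real m \<le> K * real n \<Longrightarrow>
      real n \<le> K * real m \<Longrightarrow> \<bar>ln (l m) - ln (l n)\<bar> \<le> e / 2"
      using close[OF K half_gt_zero[OF e]] by blast
    have "\<forall>\<^sub>F x in at_top. (real N + 2) * max 1 (1 / c) \<le> x" by (rule eventually_ge_at_top)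
    then show "\<forall>\<^sub>F x in at_top.
        dist (ln (l (max 1 (nat \<lfloor>c * x\<rfloor>))) - ln (l (max 1 (nat \<lfloor>x\<rfloor>)))) 0 < e"
    proof eventually_elim
      case (elim x)
      have "(real N + 2) * 1 \<le> (real N + 2) * max 1 (1 / c)" by (intro mult_left_mono) auto
      then have x: "real N + 2 \<le> x" using elim by (metis mult_1_right order_trans)
      have "(real N + 2) * (1 / c) \<le> (real N + 2) * max 1 (1 / c)" by (intro mult_left_mono) auto
      then have "(real N + 2) * (1 / c) \<le> x" using elim by (metis order_trans)
      then have cx: "real N + 2 \<le> c * x" using c by (simp add: field_simps)
      define n m where "n = nat \<lfloor>x\<rfloor>" and "m = nat \<lfloor>c * x\<rfloor>"
      have n: "real n \<le> x" "x < real n + 1" using x by (auto simp: n_def)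
      have m: "real m \<le> c * x" "c * x < real m + 1" using cx by (auto simp: m_def)
      have ge: "N + 1 \<le> n" "N + 1 \<le> m" using n m x cx by linarith+
      have "c * x \<le> c * (2 * real n)" using n ge c by (intro mult_left_mono) auto
      also have "\<dots> \<le> K * real n" using mult_right_mono[of "2 * c" K "real n"] by (simp add: K_def)
      finally have 1: "real m \<le> K * real n" using m by linarith
      have "x \<le> 2 / c * real m" using m ge c by (simp add: field_simps)
      also have "\<dots> \<le> K * real m" by (intro mult_right_mono) (auto simp: K_def)
      finally have 2: "real n \<le> K * real m" using n by linarith
      have "\<bar>ln (l m) - ln (l n)\<bar> \<le> e / 2" using N[of m n] ge 1 2 by simp
      then show ?case using e ge unfolding n_def m_def by (simp add: dist_real_def max_def)
    qed
  qed
  then have "((\<lambda>x. exp (ln (l (max 1 (nat \<lfloor>c * x\<rfloor>))) - ln (l (max 1 (nat \<lfloor>x\<rfloor>))))) \<longlongrightarrow> exp 0) at_top"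
    by (rule tendsto_exp)
  then show "((\<lambda>x. l (max 1 (nat \<lfloor>c * x\<rfloor>)) / l (max 1 (nat \<lfloor>x\<rfloor>))) \<longlongrightarrow> 1) at_top"
    by (simp add: exp_diff pos)
qed

text \<open>For fixed \<open>j\<close> the differences \<open>i - j\<close> are distinct and below
  \<open>n\<close>, so \<open>w j\<close> meets each value of \<open>a\<close> at most once. With
  \<open>m = J = 0\<close> this bounds the partial sums of the convolution; with \<open>J\<close>
  large it isolates what the tail of \<open>w\<close> contributes.\<close>

lemma convolution_window_le:
  fixes a w :: "nat \<Rightarrow> real"
  assumes "\<And>n. 0 \<le> a n" "\<And>n. 0 \<le> w n"
  shows "(\<Sum>i\<in>{m..<n}. \<Sum>j\<in>{J..i}. w j * a (i - j)) \<le> (\<Sum>j\<in>{J..<n}. w j) * (\<Sum>k<n. a k)"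
proof -
  have "(\<Sum>i\<in>{m..<n}. \<Sum>j\<in>{J..i}. w j * a (i - j)) \<le> (\<Sum>i<n. \<Sum>j\<in>{J..i}. w j * a (i - j))"
    by (intro sum_mono2 sum_nonneg) (auto simp: assms)
  also have "\<dots> = (\<Sum>i<n. \<Sum>j\<in>{J..<n}. if j \<le> i then w j * a (i - j) else 0)"
    by (intro sum.cong[OF refl] sum.mono_neutral_cong_left) auto
  also have "\<dots> = (\<Sum>j\<in>{J..<n}. \<Sum>i<n. if j \<le> i then w j * a (i - j) else 0)"
    by (rule sum.swap)
  also have "\<dots> \<le> (\<Sum>j\<in>{J..<n}. w j * (\<Sum>k<n. a k))"
  proof (rule sum_mono)
    fix j assume j: "j \<in> {J..<n}"
    have "(\<Sum>i<n. if j \<le> i then w j * a (i - j) else 0) = (\<Sum>i\<in>{j..<n}. w j * a (i - j))"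
      by (intro sum.mono_neutral_cong_right) auto
    also have "\<dots> = (\<Sum>k<n - j. w j * a k)"
      by (rule sum.reindex_bij_witness[of _ "\<lambda>k. k + j" "\<lambda>i. i - j"]) auto
    also have "\<dots> = w j * (\<Sum>k<n - j. a k)" by (rule sum_distrib_left[symmetric])
    also have "\<dots> \<le> w j * (\<Sum>k<n. a k)"
      by (intro mult_left_mono sum_mono2) (auto simp: assms)
    finally show "(\<Sum>i<n. if j \<le> i then w j * a (i - j) else 0) \<le> w j * (\<Sum>k<n. a k)" .
  qed
  also have "\<dots> = (\<Sum>j\<in>{J..<n}. w j) * (\<Sum>k<n. a k)" by (rule sum_distrib_right[symmetric])
  finally show ?thesis .
qed

text \<open>The bound \<open>p n / a n \<ge> (\<Sum>j\<le>n. w j)\<close> is immediate. For the other one, \<open>p n\<close> is at most the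
  average of \<open>p\<close> over the last \<open>n div q\<close> indices; averaging tames the terms \<open>w j * a (n - j)\<close>
  with \<open>j\<close> close to \<open>n\<close>.\<close>

lemma convolution_asymptotics:
  fixes a w p :: "nat \<Rightarrow> real"
  assumes p: "\<And>n. p n = (\<Sum>j\<le>n. w j * a (n - j))" "decseq p"
    and w: "\<And>n. 0 \<le> w n" "summable w"
    and a: "\<And>n. 0 < a n" "decseq a" and \<rho>: "0 < \<rho>"
    and lim: "(\<lambda>n. real n * a n / (\<Sum>k<n. a k)) \<longlonglongrightarrow> \<rho>"
  shows "(\<lambda>n. p n / a n) \<longlonglongrightarrow> suminf w"
proof -
  define A r V where "A n = (\<Sum>k<n. a k)" and "r n = real n * a n / A n" and "V = suminf w" for n
  have r: "r \<longlonglongrightarrow> \<rho>" using lim unfolding r_def A_def by simp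
  have A_pos: "0 < A n" if "1 \<le> n" for n
    unfolding A_def using that a by (intro sum_pos) (auto simp: lessThan_empty_iff)
  have A_mono: "mono A" unfolding A_def by (intro monoI sum_mono2) (auto simp: less_imp_le a)
  have V: "0 \<le> V" "\<And>n. sum w {..<n} \<le> V" unfolding V_def
    by (auto intro!: suminf_nonneg sum_le_suminf w)
  have lower: "(\<Sum>j\<le>n. w j) \<le> p n / a n" for n
  proof -
    have "(\<Sum>j\<le>n. w j) * a n \<le> p n" unfolding p(1) sum_distrib_right
      by (intro sum_mono mult_left_mono w decseqD[OF a(2)]) auto
    then show ?thesis using a(1)[of n] by (simp add: field_simps)
  qed
  have lower_lim: "(\<lambda>n. \<Sum>j\<le>n. w j) \<longlonglongrightarrow> V"
    using summable_LIMSEQ'[OF w(2)] by (simp add: V_def)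
  have upper: "\<forall>\<^sub>F n in sequentially. p n / a n < V + e" if e: "0 < e" for e
  proof -
    \<comment> \<open>The window is the fraction \<open>1 / q\<close> of \<open>n\<close>. For
      \<open>j < J\<close> the convolution meets \<open>a\<close> no earlier than
      \<open>l n\<close>, about \<open>(1 - 1 / q) n\<close>, which inflates \<open>V\<close> to at
      most \<open>V / (1 - 1 / q)\<close> in the limit.\<close>
    have "(\<lambda>q. V / (1 - 1 / real q)) \<longlonglongrightarrow> V / (1 - 0)"
      by (intro tendsto_intros lim_1_over_n) auto
    then have "\<forall>\<^sub>F q in sequentially. V / (1 - 1 / real q) < V + e / 2"
      using e by (intro order_tendstoD) auto
    then have "\<forall>\<^sub>F q in sequentially. V / (1 - 1 / real q) < V + e / 2 \<and> 2 \<le> q"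
      using eventually_ge_at_top[of 2] by eventually_elim auto
    then obtain q where q: "V / (1 - 1 / real q) < V + e / 2" "2 \<le> q"
      using eventually_happens'[OF sequentially_bot] by blast
    \<comment> \<open>\<open>J\<close> is chosen after \<open>q\<close>: the indices from
      \<open>J\<close> on contribute at most \<open>T * A n / k n\<close>, and this divided by
      \<open>a n\<close> tends to \<open>T * q / \<rho>\<close>.\<close>
    have "(\<lambda>J. (V - sum w {..<J}) * (real q / \<rho>)) \<longlonglongrightarrow> (V - V) * (real q / \<rho>)"
      using summable_LIMSEQ[OF w(2)] by (intro tendsto_intros) (simp add: V_def)
    then have "\<forall>\<^sub>F J in sequentially. (V - sum w {..<J}) * (real q / \<rho>) < e / 2"
      using e by (intro order_tendstoD) auto
    then obtain J where J: "(V - sum w {..<J}) * (real q / \<rho>) < e / 2"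
      using eventually_happens'[OF sequentially_bot] by blast
    define T where "T = V - sum w {..<J}"
    have T: "0 \<le> T" using V(2)[of J] by (simp add: T_def)
    have wT: "(\<Sum>j\<in>{J..<n}. w j) \<le> T" for n
    proof (cases "J \<le> n")
      case True
      then have "sum w {..<J} + sum w {J..<n} = sum w {..<n}"
        by (metis lessThan_atLeast0 sum.atLeastLessThan_concat zero_le)
      then show ?thesis using V(2)[of n] by (simp add: T_def)
    qed (use T in auto)
    define k l where "k n = n div q" and "l n = n - n div q - J" for n
    have k_lim: "(\<lambda>n. real (k n) / real n) \<longlonglongrightarrow> 1 / real q"
    proof (rule tendsto_sandwich)
      have "(\<lambda>n. 1 / real q - 1 / real n) \<longlonglongrightarrow> 1 / real q - 0" by (intro tendsto_intros lim_1_over_n)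
      then show "(\<lambda>n. 1 / real q - 1 / real n) \<longlonglongrightarrow> 1 / real q" by simp
      show "\<forall>\<^sub>F n in sequentially. 1 / real q - 1 / real n \<le> real (k n) / real n"
        using eventually_ge_at_top[of 1]
      proof eventually_elim
        case (elim n)
        have "real n / real q - 1 \<le> real (k n)" 
          using floor_divide_of_nat_eq[where 'a=real, of n q] unfolding k_def by linarith
        then have "(real n / real q - 1) / real n \<le> real (k n) / real n" by (rule divide_right_mono) simp
        then show ?case using elim by (simp add: diff_divide_distrib)
      qed
      show "\<forall>\<^sub>F n in sequentially. real (k n) / real n \<le> 1 / real q"
        using eventually_ge_at_top[of 1]
      proof eventually_elim
        case (elim n)
        have "real (k n) \<le> real n / real q" using of_nat_div_le_of_nat[where 'a=real, of n q] by (simp add: k_def)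
        then have "real (k n) / real n \<le> real n / real q / real n" by (rule divide_right_mono) simp
        then show ?case using elim by simp
      qed
    qed (rule tendsto_const)
    have l_large: "real l' \<le> real (l n)" if "2 * (l' + J) \<le> n" for l' n
    proof -
      have "n div q \<le> n div 2" using q by (intro div_le_mono2) auto
      moreover have "n div 2 * 2 \<le> n" by (rule div_times_less_eq_dividend)
      ultimately have "l' + J + n div q \<le> n" using that by simp
      then show ?thesis by (simp add: l_def)
    qed
    have l_inf: "filterlim l at_top sequentially" unfolding filterlim_at_top
      using l_large by (auto intro!: eventually_sequentiallyI)
    have l_lim: "(\<lambda>n. real (l n) / real n) \<longlonglongrightarrow> 1 - 1 / real q"
    proof -
      have "(\<lambda>n. 1 - real (k n) / real n - real J * (1 / real n)) \<longlonglongrightarrow> 1 - 1 / real q - real J * 0"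
        by (intro tendsto_intros k_lim lim_1_over_n)
      then have "(\<lambda>n. 1 - real (k n) / real n - real J * (1 / real n)) \<longlonglongrightarrow> 1 - 1 / real q" by simp
      then show ?thesis
      proof (rule Lim_transform_eventually)
        show "\<forall>\<^sub>F n in sequentially. 1 - real (k n) / real n - real J * (1 / real n) = real (l n) / real n"
          using eventually_ge_at_top[of "2 * J + 1"]
        proof eventually_elim
          case (elim n)
          have "n div q \<le> n div 2" using q by (intro div_le_mono2) auto
          moreover have "n div 2 * 2 \<le> n" by (rule div_times_less_eq_dividend)
          ultimately have "k n + J \<le> n" using elim unfolding k_def by simp
          then have "real (l n) = real n - real (k n) - real J" by (simp add: l_def k_def of_nat_diff)
          then show ?case using elim by (simp add: diff_divide_distrib)
        qed
      qed
    qed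
    \<comment> \<open>\<open>R n\<close> will dominate \<open>p n / a n\<close> and is built from
      convergent ratios. Its first term comes from \<open>a (l n) / a n\<close> by way of
      \<open>A (l n) \<le> A n\<close>.\<close>
    define R where "R n = V * (r (l n) / r n / (real (l n) / real n)) +
        T * (1 / (real (k n) / real n) / r n)" for n
    have q1: "0 < 1 - 1 / real q" using q by simp
    have "R \<longlonglongrightarrow> V * (\<rho> / \<rho> / (1 - 1 / real q)) + T * (1 / (1 / real q) / \<rho>)"
      unfolding R_def using \<rho> q q1
      by (intro tendsto_intros r l_lim k_lim filterlim_compose[OF r l_inf]) auto
    moreover have "V * (\<rho> / \<rho> / (1 - 1 / real q)) + T * (1 / (1 / real q) / \<rho>) < V + e"
    proof -
      have "\<rho> / \<rho> / (1 - 1 / real q) = 1 / (1 - 1 / real q)"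
        "1 / (1 / real q) / \<rho> = real q / \<rho>" using \<rho> q by auto
      with q(1) J show ?thesis by (simp only: T_def times_divide_eq_right mult_1_right)
    qed
    ultimately have "\<forall>\<^sub>F n in sequentially. R n < V + e" by (rule order_tendstoD(2))
    then show ?thesis using eventually_ge_at_top[of "max q (2 * (1 + J))"]
    proof eventually_elim
      case (elim n)
      have n: "q \<le> n" "2 * (1 + J) \<le> n" using elim by auto
      have k1: "1 \<le> k n" using n q by (simp add: k_def div_greater_zero_iff Suc_le_eq)
      have l1: "1 \<le> l n" using l_large[OF n(2)] by simp
      have kl: "l n + J = n - k n" using l1 by (simp add: k_def l_def)
      have kn: "k n \<le> n" by (simp add: k_def)
      have "real (k n) * p n = (\<Sum>i\<in>{n - k n..<n}. p n)" using kn by simp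
      also have "\<dots> \<le> (\<Sum>i\<in>{n - k n..<n}. p i)"
        by (intro sum_mono decseqD[OF p(2)]) auto
      also have "\<dots> = (\<Sum>i\<in>{n - k n..<n}. (\<Sum>j<J. w j * a (i - j)) + (\<Sum>j\<in>{J..i}. w j * a (i - j)))"
      proof (rule sum.cong[OF refl])
        fix i assume "i \<in> {n - k n..<n}"
        then have "{..i} = {..<J} \<union> {J..i}" using kl by auto
        then show "p i = (\<Sum>j<J. w j * a (i - j)) + (\<Sum>j\<in>{J..i}. w j * a (i - j))"
          unfolding p(1) by (subst sum.union_disjoint[symmetric]) auto
      qed
      also have "\<dots> = (\<Sum>i\<in>{n - k n..<n}. \<Sum>j<J. w j * a (i - j)) + (\<Sum>i\<in>{n - k n..<n}. \<Sum>j\<in>{J..i}. w j * a (i - j))"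
        by (rule sum.distrib)
      also have "\<dots> \<le> real (k n) * (V * a (l n)) + T * A n"
      proof (rule add_mono)
        \<comment> \<open>Here \<open>i - j\<close> is at least \<open>l n\<close>, because
          \<open>i \<ge> n - k n\<close> and \<open>j < J\<close>.\<close>
        have "(\<Sum>j<J. w j * a (i - j)) \<le> V * a (l n)" if "i \<in> {n - k n..<n}" for i
        proof -
          have "(\<Sum>j<J. w j * a (i - j)) \<le> (\<Sum>j<J. w j * a (l n))"
            using that kl by (intro sum_mono mult_left_mono w decseqD[OF a(2)]) auto
          also have "\<dots> = (\<Sum>j<J. w j) * a (l n)" by (rule sum_distrib_right[symmetric])
          also have "\<dots> \<le> V * a (l n)" by (intro mult_right_mono V less_imp_le a)
          finally show ?thesis .
        qed
        then have "(\<Sum>i\<in>{n - k n..<n}. \<Sum>j<J. w j * a (i - j)) \<le> (\<Sum>i\<in>{n - k n..<n}. V * a (l n))"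
          by (rule sum_mono)
        then show "(\<Sum>i\<in>{n - k n..<n}. \<Sum>j<J. w j * a (i - j)) \<le> real (k n) * (V * a (l n))"
          using kn by simp
        have "(\<Sum>i\<in>{n - k n..<n}. \<Sum>j\<in>{J..i}. w j * a (i - j)) \<le> (\<Sum>j\<in>{J..<n}. w j) * A n"
          unfolding A_def by (rule convolution_window_le) (auto simp: less_imp_le a w)
        also have "\<dots> \<le> T * A n"
          using A_pos[of n] n by (intro mult_right_mono wT) auto
        finally show "(\<Sum>i\<in>{n - k n..<n}. \<Sum>j\<in>{J..i}. w j * a (i - j)) \<le> T * A n" .
      qed
      finally have main: "real (k n) * p n \<le> real (k n) * (V * a (l n)) + T * A n" .
      have "p n \<le> V * a (l n) + T * (A n / real (k n))"
        using main k1 by (simp add: field_simps)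
      then have "p n / a n \<le> (V * a (l n) + T * (A n / real (k n))) / a n"
        by (intro divide_right_mono) (auto simp: less_imp_le a)
      also have "\<dots> = V * (a (l n) / a n) + T * (A n / real (k n) / a n)"
        by (simp add: add_divide_distrib)
      also have "A n / real (k n) / a n = 1 / (real (k n) / real n) / r n"
        using n k1 a(1)[of n] by (simp add: r_def)
      also have "a (l n) / a n \<le> r (l n) / r n / (real (l n) / real n)"
      proof -
        have "A (l n) \<le> A n" by (intro monoD[OF A_mono]) (simp add: l_def)
        then have "a (l n) / a n * 1 \<le> a (l n) / a n * (A n / A (l n))"
          using A_pos[OF l1] by (intro mult_left_mono) (auto simp: less_imp_le a)
        also have "\<dots> = r (l n) / r n / (real (l n) / real n)"
          using n l1 a(1)[of n] A_pos[OF l1] A_pos[of n] by (simp add: r_def field_simps)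
        finally show ?thesis by simp
      qed
      finally have "p n / a n \<le> R n" unfolding R_def using V(1) by (simp add: mult_left_mono)
      then show ?case using elim by simp
    qed
  qed
  show ?thesis unfolding V_def[symmetric]
  proof (rule order_tendstoI)
    fix y assume "y < V"
    then have "\<forall>\<^sub>F n in sequentially. y < (\<Sum>j\<le>n. w j)" by (rule order_tendstoD(1)[OF lower_lim])
    then show "\<forall>\<^sub>F n in sequentially. y < p n / a n"
      by eventually_elim (use lower in \<open>auto intro: less_le_trans\<close>)
  next
    fix y assume "V < y"
    then show "\<forall>\<^sub>F n in sequentially. p n / a n < y" using upper[of "y - V"] by simp
  qed
qed

text \<open>With \<open>W n = (\<Sum>j\<le>n. w j)\<close>, monotonicity of \<open>p\<close> gives \<open>p n \<le> C * W n * a n\<close>, hence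
  \<open>W (2 * n) \<le> W n * (1 + C * a n * F n)\<close>.\<close>

lemma summable_of_dyadic_growth:
  fixes a w p F :: "nat \<Rightarrow> real"
  assumes p: "\<And>n. p n = (\<Sum>j\<le>n. w j * a (n - j))" "decseq p"
    and w: "\<And>n. 0 \<le> w n"
    and a: "\<And>n. 0 < a n" and \<rho>: "0 < \<rho>"
    and lim: "(\<lambda>n. real n * a n / (\<Sum>k<n. a k)) \<longlonglongrightarrow> \<rho>"
    and F: "\<And>n. 0 \<le> F n" "\<And>n. (\<Sum>j\<in>{n<..2 * n}. w j) \<le> p n * F n"
    and sF: "summable (\<lambda>i. a (2 ^ i) * F (2 ^ i))"
  shows "summable w"
proof -
  define A W where "A n = (\<Sum>k<n. a k)" and "W n = (\<Sum>j\<le>n. w j)" for n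
  have W: "0 \<le> W n" for n unfolding W_def by (intro sum_nonneg w)
  have A_pos: "0 < A n" if "1 \<le> n" for n
    unfolding A_def using that a by (intro sum_pos) (auto simp: lessThan_empty_iff)
  have "\<forall>\<^sub>F n in sequentially. \<rho> / 2 < real n * a n / A n"
    using lim \<rho> unfolding A_def by (intro order_tendstoD) auto
  then obtain N where N: "\<And>n. N \<le> n \<Longrightarrow> \<rho> / 2 < real n * a n / A n"
    unfolding eventually_sequentially by blast
  \<comment> \<open>From \<open>n a n / A n > \<rho> / 2\<close>, which reads
    \<open>A n \<le> C n a n\<close>.\<close>
  define C where "C = 2 / \<rho>"
  have C: "0 < C" using \<rho> by (simp add: C_def)
  have p_le: "p n \<le> C * W n * a n" if n: "N \<le> n" "1 \<le> n" for n
  proof -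
    have "real n * p n = (\<Sum>i\<in>{0..<n}. p n)" by simp
    also have "\<dots> \<le> (\<Sum>i\<in>{0..<n}. p i)" by (intro sum_mono decseqD[OF p(2)]) auto
    also have "\<dots> = (\<Sum>i\<in>{0..<n}. \<Sum>j\<in>{0..i}. w j * a (i - j))"
      unfolding p(1) by (simp add: atLeast0AtMost)
    also have "\<dots> \<le> (\<Sum>j\<in>{0..<n}. w j) * A n"
      unfolding A_def by (rule convolution_window_le) (auto simp: less_imp_le a w)
    also have "\<dots> \<le> W n * A n" unfolding W_def
      using A_pos[OF n(2)] by (intro mult_right_mono sum_mono2) (auto simp: w)
    also have "\<dots> \<le> W n * (C * real n * a n)"
    proof (intro mult_left_mono W)
      show "A n \<le> C * real n * a n"
        using N[OF n(1)] A_pos[OF n(2)] \<rho> by (simp add: C_def field_simps)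
    qed
    finally have "real n * p n \<le> real n * (C * W n * a n)" by (simp add: ac_simps)
    then show ?thesis using n by simp
  qed
  \<comment> \<open>Passing from \<open>1 + x\<close> to \<open>exp x\<close> turns the product over
    successive doublings into the exponential of a partial sum of the series in
    \<open>sF\<close>.\<close>
  have double: "W (2 * n) \<le> W n * exp (C * (a n * F n))" if n: "N \<le> n" "1 \<le> n" for n
  proof -
    have "{..2 * n} = {..n} \<union> {n<..2 * n}" by auto
    then have "W (2 * n) = sum w ({..n} \<union> {n<..2 * n})" by (simp only: W_def)
    also have "\<dots> = W n + (\<Sum>j\<in>{n<..2 * n}. w j)"
      unfolding W_def by (intro sum.union_disjoint) auto
    also have "\<dots> \<le> W n + p n * F n" using F(2)[of n] by simp
    also have "\<dots> \<le> W n + C * W n * a n * F n"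
      by (intro add_left_mono mult_right_mono p_le n F)
    also have "\<dots> = W n * (1 + C * (a n * F n))" by (simp add: algebra_simps)
    also have "\<dots> \<le> W n * exp (C * (a n * F n))"
      by (intro mult_left_mono W) (auto intro: exp_ge_add_one_self)
    finally show ?thesis .
  qed
  define s where "s i = a (2 ^ i) * F (2 ^ i)" for i
  have s: "0 \<le> s i" for i unfolding s_def using a[of "2 ^ i"] F(1) by simp
  have N2: "N \<le> 2 ^ (N + i)" for i
    by (rule order_trans[OF less_imp_le[OF less_exp]]) (auto intro: power_increasing)
  have it: "W (2 ^ (N + i)) \<le> W (2 ^ N) * exp (C * (\<Sum>l<i. s (N + l)))" for i
  proof (induction i)
    case (Suc i)
    have "W (2 ^ (N + Suc i)) \<le> W (2 ^ (N + i)) * exp (C * s (N + i))"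
      using double[of "2 ^ (N + i)"] N2[of i] by (simp add: s_def)
    also have "\<dots> \<le> W (2 ^ N) * exp (C * (\<Sum>l<i. s (N + l))) * exp (C * s (N + i))"
      by (intro mult_right_mono Suc) auto
    also have "\<dots> = W (2 ^ N) * exp (C * (\<Sum>l<Suc i. s (N + l)))"
      by (simp add: distrib_left exp_add)
    finally show ?case .
  qed simp
  have "sum w {..<n} \<le> W (2 ^ N) * exp (C * suminf s)" for n
  proof -
    have "sum w {..<n} \<le> W (2 ^ (N + n))" unfolding W_def
    proof (rule sum_mono2)
      have "n < 2 ^ n" by (rule less_exp)
      also have "(2::nat) ^ n \<le> 2 ^ (N + n)" by (intro power_increasing) auto
      finally show "{..<n} \<subseteq> {..2 ^ (N + n)}" by auto
    qed (auto simp: w)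
    also have "\<dots> \<le> W (2 ^ N) * exp (C * (\<Sum>l<n. s (N + l)))" by (rule it)
    also have "\<dots> \<le> W (2 ^ N) * exp (C * suminf s)"
    proof -
      have "(\<Sum>l<n. s (N + l)) = sum s {N..<N + n}"
        by (rule sum.reindex_bij_witness[of _ "\<lambda>l. l - N" "\<lambda>l. N + l"]) auto
      also have "\<dots> \<le> suminf s"
        using sF by (intro sum_le_suminf) (auto simp: s s_def[symmetric])
      finally show ?thesis using C by (intro mult_left_mono W) simp
    qed
    finally show ?thesis .
  qed
  then show ?thesis by (intro summableI_nonneg_bounded w)
qed

text \<open>By regular variation \<open>a (2 n) / a n\<close> tends to
  \<open>2 powr (\<rho> - 1)\<close>, which is below 1 because \<open>\<rho> < 1\<close>.
  Consequently the mass that \<open>T_0\<close> puts on \<open>(n, 2 n]\<close> is comparable to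
  \<open>a n\<close>.\<close>

lemma dyadic_decay:
  fixes a :: "nat \<Rightarrow> real"
  assumes a: "\<And>n. 0 < a n" and \<rho>: "0 < \<rho>" "\<rho> < 1"
    and lim: "(\<lambda>n. real n * a n / (\<Sum>k<n. a k)) \<longlonglongrightarrow> \<rho>"
  obtains \<theta> N where "0 < \<theta>" "\<theta> < 1" "\<And>n. N \<le> n \<Longrightarrow> a (2 * n) \<le> \<theta> * a n"
proof -
  \<comment> \<open>Half of the gap \<open>(1 - \<rho>) ln 2\<close> absorbs the error of the
    approximation; the other half is left for \<open>\<theta> = exp (- e)\<close>.\<close>
  define e where "e = (1 - \<rho>) * ln 2 / 2"
  have e: "0 < e" using \<rho> by (simp add: e_def)
  obtain N where N: "\<And>m n. N \<le> m \<Longrightarrow> N \<le> n \<Longrightarrow> real m \<le> 2 * real n \<Longrightarrow> real n \<le> 2 * real m \<Longrightarrow>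
    \<bar>ln (a m * real m powr (1 - \<rho>)) - ln (a n * real n powr (1 - \<rho>))\<bar> \<le> e"
    using regular_variation_of_ratio[OF a \<rho>(1) lim, of 2 e] e by auto
  show ?thesis
  proof (rule that[of "exp (- e)" "max N 1"])
    fix n assume n: "max N 1 \<le> n"
    have l: "ln (a m * real m powr (1 - \<rho>)) = ln (a m) + (1 - \<rho>) * ln (real m)" if "1 \<le> m" for m
      using that a[of m] by (simp add: ln_mult ln_powr)
    have "\<bar>ln (a (2 * n)) + (1 - \<rho>) * ln (real (2 * n)) - (ln (a n) + (1 - \<rho>) * ln (real n))\<bar> \<le> e"
      using N[of "2 * n" n] n l[of "2 * n"] l[of n] by simp
    moreover have "ln (real (2 * n)) = ln 2 + ln (real n)" using n by (simp add: ln_mult)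
    ultimately have "ln (a (2 * n)) \<le> ln (a n) + e - (1 - \<rho>) * ln 2"
      by (simp add: abs_le_iff algebra_simps)
    also have "\<dots> = ln (exp (- e) * a n)" using a[of n] by (simp add: ln_mult e_def)
    finally show "a (2 * n) \<le> exp (- e) * a n" using a[of n] a[of "2 * n"] by (subst (asm) ln_le_cancel_iff) auto
  qed (use e in auto)
qed

section \<open>Record epochs of a sequence\<close>

abbreviation csum :: "nat \<Rightarrow> (nat \<Rightarrow> real) \<Rightarrow> real" where
  "csum \<equiv> walk (\<lambda>i x. x i)"

definition seq_shift :: "nat \<Rightarrow> (nat \<Rightarrow> real) \<Rightarrow> nat \<Rightarrow> real" where
  "seq_shift i x = (\<lambda>k. x (i + k))"

definition is_record :: "nat \<Rightarrow> (nat \<Rightarrow> real) \<Rightarrow> bool" where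
  "is_record n x \<longleftrightarrow> (\<forall>j<n. csum n x < csum j x)"

text \<open>The event \<open>T_g > n\<close>, written through the first \<open>n\<close> partial
  sums only; see \<open>stays_above_iff_passage_time\<close>. Time 0 is exempt, as in
  \<open>passage_time\<close>.\<close>

definition stays_above :: "(real \<Rightarrow> real) \<Rightarrow> nat \<Rightarrow> (nat \<Rightarrow> real) \<Rightarrow> bool" where
  "stays_above g n x \<longleftrightarrow> (\<forall>k\<in>{1..n}. - g (real k) \<le> csum k x)"

abbreviation nonneg :: "nat \<Rightarrow> (nat \<Rightarrow> real) \<Rightarrow> bool" where
  "nonneg \<equiv> stays_above (\<lambda>_. 0)"

text \<open>The event \<open>T_0 = n\<close>, likewise free of \<open>enat\<close>.\<close>

definition first_record :: "nat \<Rightarrow> (nat \<Rightarrow> real) \<Rightarrow> bool" where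
  "first_record n x \<longleftrightarrow> 1 \<le> n \<and> nonneg (n - 1) x \<and> csum n x < 0"

section \<open>Shifts, concatenation and the structure of records\<close>

lemma csum_0 [simp]: "csum 0 x = 0"
  by (simp add: walk_def)

lemma csum_add: "csum (i + m) x = csum i x + csum m (seq_shift i x)"
  by (induction m) (simp_all add: walk_def seq_shift_def)

lemma csum_shift: "i \<le> k \<Longrightarrow> csum (k - i) (seq_shift i x) = csum k x - csum i x"
  using csum_add[of i "k - i" x] by simp

text \<open>That an event depends on the first \<open>i\<close> increments only is expressed as
  invariance under \<open>comb_seq i x y\<close>, which keeps the first \<open>i\<close> entries of
  \<open>x\<close> and continues with \<open>y\<close>.\<close>

lemma csum_comb_seq: "k \<le> i \<Longrightarrow> csum k (comb_seq i x y) = csum k x"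
  unfolding walk_def by (intro sum.cong) (auto simp: comb_seq_less)

lemma shift_comb_seq: "seq_shift i (comb_seq i x y) = y"
  unfolding seq_shift_def by (auto simp: comb_seq_def)

lemma record_comb_seq: "n \<le> i \<Longrightarrow> is_record n (comb_seq i x y) = is_record n x"
  unfolding is_record_def by (simp add: csum_comb_seq)

lemma stays_above_comb_seq: "n \<le> i \<Longrightarrow> stays_above g n (comb_seq i x y) = stays_above g n x"
  unfolding stays_above_def by (intro ball_cong) (auto simp add: csum_comb_seq)

lemma first_record_comb_seq: "n \<le> i \<Longrightarrow> first_record n (comb_seq i x y) = first_record n x"
  unfolding first_record_def by (auto simp: stays_above_comb_seq csum_comb_seq)

lemma nonneg_shift_iff:
  "nonneg m (seq_shift j x) \<longleftrightarrow> (\<forall>k\<in>{j..j + m}. csum j x \<le> csum k x)"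
proof
  assume L: "nonneg m (seq_shift j x)"
  show "\<forall>k\<in>{j..j + m}. csum j x \<le> csum k x"
  proof
    fix k assume k: "k \<in> {j..j + m}"
    then have "k = j \<or> k - j \<in> {1..m}" by auto
    with L have "k = j \<or> 0 \<le> csum (k - j) (seq_shift j x)" unfolding stays_above_def by fastforce
    with k show "csum j x \<le> csum k x" by (auto simp: csum_shift)
  qed
next
  assume R: "\<forall>k\<in>{j..j + m}. csum j x \<le> csum k x"
  show "nonneg m (seq_shift j x)" unfolding stays_above_def
  proof
    fix k assume "k \<in> {1..m}"
    then have "csum j x \<le> csum (j + k) x" using R by auto
    then show "- 0 \<le> csum k (seq_shift j x)" by (simp add: csum_add)
  qed
qed

lemma record_shift_iff:
  "is_record m (seq_shift j x) \<longleftrightarrow> (\<forall>k\<in>{j..<j + m}. csum (j + m) x < csum k x)"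
proof
  assume L: "is_record m (seq_shift j x)"
  show "\<forall>k\<in>{j..<j + m}. csum (j + m) x < csum k x"
  proof
    fix k assume k: "k \<in> {j..<j + m}"
    with L have "csum m (seq_shift j x) < csum (k - j) (seq_shift j x)" unfolding is_record_def by auto
    with k show "csum (j + m) x < csum k x" by (auto simp: csum_shift csum_add)
  qed
next
  assume R: "\<forall>k\<in>{j..<j + m}. csum (j + m) x < csum k x"
  show "is_record m (seq_shift j x)" unfolding is_record_def
  proof (intro allI impI)
    fix k assume "k < m"
    then have "csum (j + m) x < csum (j + k) x" using R by auto
    then show "csum m (seq_shift j x) < csum k (seq_shift j x)" by (simp add: csum_add)
  qed
qed

text \<open>A record is a strict minimum of its past, so falling below the level at \<open>i\<close>
  means falling below everything earlier as well. This is the regeneration property of record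
  epochs.\<close>

lemma record_add_iff:
  assumes "is_record i x"
  shows "is_record (i + m) x \<longleftrightarrow> is_record m (seq_shift i x)"
  unfolding record_shift_iff
proof
  assume "is_record (i + m) x"
  then show "\<forall>k\<in>{i..<i + m}. csum (i + m) x < csum k x" unfolding is_record_def by auto
next
  assume R: "\<forall>k\<in>{i..<i + m}. csum (i + m) x < csum k x"
  show "is_record (i + m) x" unfolding is_record_def
  proof (intro allI impI)
    fix j assume j: "j < i + m"
    show "csum (i + m) x < csum j x"
    proof (cases "j < i")
      case True
      then have "csum i x < csum j x" using assms by (simp add: is_record_def)
      moreover have "csum (i + m) x \<le> csum i x" using R by (cases "m = 0") (auto simp: less_imp_le)
      ultimately show ?thesis by simp
    qed (use R j in auto)
  qed
qed

lemma record_nonpos: "is_record n x \<Longrightarrow> csum n x \<le> 0"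
  unfolding is_record_def by (cases "n = 0") (auto dest: spec[of _ 0])

lemma first_record_record: "first_record n x \<Longrightarrow> is_record n x"
proof -
  assume L: "first_record n x"
  show "is_record n x" unfolding is_record_def
  proof (intro allI impI)
    fix j assume "j < n"
    then have "j = 0 \<or> j \<in> {1..n - 1}" by auto
    then show "csum n x < csum j x" using L unfolding first_record_def stays_above_def by fastforce
  qed
qed

lemma first_record_unique: "first_record i x \<Longrightarrow> first_record j x \<Longrightarrow> i = j"
proof (induction i j rule: linorder_wlog)
  case (le a b)
  show ?case
  proof (rule ccontr)
    assume "a \<noteq> b"
    with le have "a \<in> {1..b - 1}" unfolding first_record_def by auto
    with le show False unfolding first_record_def stays_above_def by fastforce
  qed
qed auto

lemma ex_first_record:
  assumes "\<not> nonneg n x"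
  obtains k where "k \<in> {1..n}" "first_record k x"
proof -
  define k where "k = (LEAST k. 1 \<le> k \<and> csum k x < 0)"
  from assms obtain l where l: "l \<in> {1..n}" "csum l x < 0"
    unfolding stays_above_def by (auto simp: not_le)
  then have k: "1 \<le> k \<and> csum k x < 0" unfolding k_def by (metis (mono_tags, lifting) LeastI atLeastAtMost_iff)
  have "k \<le> l" unfolding k_def using l by (simp add: Least_le)
  moreover have "nonneg (k - 1) x" unfolding stays_above_def
  proof
    fix j assume "j \<in> {1..k - 1}"
    then have "j < k" "1 \<le> j" by auto
    then show "- 0 \<le> csum j x" using not_less_Least[of j "\<lambda>k. 1 \<le> k \<and> csum k x < 0"]
      unfolding k_def by auto
  qed
  ultimately show ?thesis using that[of k] k l unfolding first_record_def by auto
qed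

lemma first_record_not_nonneg: "first_record k x \<Longrightarrow> k \<le> n \<Longrightarrow> \<not> nonneg n x"
  unfolding first_record_def stays_above_def by (auto intro!: bexI[of _ k])

lemma first_record_nonneg: "first_record k x \<Longrightarrow> n < k \<Longrightarrow> nonneg n x"
  unfolding first_record_def stays_above_def by auto

text \<open>The last record up to \<open>n\<close> is the first argmin of \<open>csum\<close> on
  \<open>{0..n}\<close>: strictly below the past, weakly below the future. A finite range has
  exactly one first argmin.\<close>

lemma ex1_last_record: "\<exists>!j. j \<le> n \<and> is_record j x \<and> nonneg (n - j) (seq_shift j x)"
proof -
  have iff: "j \<le> n \<and> is_record j x \<and> nonneg (n - j) (seq_shift j x) \<longleftrightarrow>
      j \<le> n \<and> (\<forall>k<j. csum j x < csum k x) \<and> (\<forall>k\<le>n. csum j x \<le> csum k x)" for j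
  proof -
    have "(\<forall>k\<le>n. csum j x \<le> csum k x) \<longleftrightarrow> (\<forall>k\<in>{j..n}. csum j x \<le> csum k x)"
      if "\<forall>k<j. csum j x < csum k x"
      using that by (meson atLeastAtMost_iff less_imp_le not_le)
    then show ?thesis unfolding nonneg_shift_iff is_record_def by auto
  qed
  obtain m where m: "m \<in> {..n}" "\<And>k. k \<in> {..n} \<Longrightarrow> csum m x \<le> csum k x"
    using arg_min_if_finite[of "{..n}" "\<lambda>k. csum k x"] that
    by (metis atMost_iff empty_iff finite_atMost le0 not_le)
  define j where "j = (LEAST j. j \<le> n \<and> csum j x = csum m x)"
  have j: "j \<le> n \<and> csum j x = csum m x"
    unfolding j_def by (rule LeastI[of _ m]) (use m in auto)
  have "csum j x < csum k x" if "k < j" for k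
    using not_less_Least[OF that[unfolded j_def]] m(2)[of k] j that by force
  with j m have ex: "j \<le> n \<and> (\<forall>k<j. csum j x < csum k x) \<and> (\<forall>k\<le>n. csum j x \<le> csum k x)" by auto
  show ?thesis unfolding iff
  proof (rule ex1I[of _ j])
    fix i assume i: "i \<le> n \<and> (\<forall>k<i. csum i x < csum k x) \<and> (\<forall>k\<le>n. csum i x \<le> csum k x)"
    show "i = j"
    proof (rule linorder_cases)
      assume "i < j"
      with i ex have "csum j x < csum i x" "csum i x \<le> csum j x" by auto
      then show ?thesis by simp
    next
      assume "j < i"
      with i ex have "csum i x < csum j x" "csum j x \<le> csum i x" by auto
      then show ?thesis by simp
    qed
  qed (fact ex)
qed

text \<open>So the first passage below an increasing boundary happens at a record epoch.\<close>

lemma stays_above_last_record: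
  assumes "mono_on {0..} g" "\<And>x. 0 \<le> x \<Longrightarrow> 0 \<le> g x"
    and "j \<le> n" "nonneg (n - j) (seq_shift j x)"
  shows "stays_above g n x \<longleftrightarrow> stays_above g j x"
proof
  show "stays_above g j x" if "stays_above g n x" using that assms(3) unfolding stays_above_def by auto
next
  assume j: "stays_above g j x"
  show "stays_above g n x" unfolding stays_above_def
  proof
    fix k assume k: "k \<in> {1..n}"
    show "- g (real k) \<le> csum k x"
    proof (cases "k \<le> j")
      case False
      then have "csum j x \<le> csum k x" using assms(3,4) k unfolding nonneg_shift_iff by auto
      moreover have "- g (real j) \<le> csum j x"
        using j assms(2)[of 0] by (cases "j = 0") (auto simp: stays_above_def)
      moreover have "g (real j) \<le> g (real k)"
        using False by (intro mono_onD[OF assms(1)]) auto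
      ultimately show ?thesis by linarith
    qed (use j k in \<open>auto simp: stays_above_def\<close>)
  qed
qed

text \<open>The right-hand side says that \<open>q\<close> is the first argmin of \<open>csum\<close> on \<open>{1..n}\<close>; \<open>y\<close> is \<open>x\<close> with its
  first \<open>n\<close> entries rotated to start at \<open>q\<close>.\<close>

lemma first_argmin_rotate:
  assumes q: "1 \<le> q" "q \<le> n"
    and y: "\<And>j. y j = x (if j < n - q then q + j else if j < n then j - (n - q) else j)"
  shows "is_record n y \<and> nonneg (n - q) y \<longleftrightarrow>
    csum n x < 0 \<and> is_record (q - 1) (seq_shift 1 x) \<and> nonneg (n - q) (seq_shift q x)"
proof -
  \<comment> \<open>\<open>y\<close> runs through the entries \<open>q, ..., n - 1\<close> of
    \<open>x\<close> and then through \<open>0, ..., q - 1\<close>. Facts \<open>1\<close> and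
    \<open>2\<close> give its partial sums on these two stretches.\<close>
  have 1: "csum k y = csum (q + k) x - csum q x" if "k \<le> n - q" for k
  proof -
    have "csum k y = csum k (seq_shift q x)" unfolding walk_def seq_shift_def
      using that by (intro sum.cong) (auto simp: y)
    then show ?thesis by (simp add: csum_add)
  qed
  have 2: "csum (n - q + k) y = csum n x - csum q x + csum k x" if "k \<le> q" for k
  proof -
    have "csum k (seq_shift (n - q) y) = csum k x" unfolding walk_def seq_shift_def
      using that q by (intro sum.cong) (auto simp: y)
    then show ?thesis using 1[of "n - q"] q csum_add[of "n - q" k y] by simp
  qed
  have n: "csum n y = csum n x" using 2[of q] q by simp
  have nn: "nonneg (n - q) y \<longleftrightarrow> nonneg (n - q) (seq_shift q x)"
    unfolding stays_above_def using 1 by (intro ball_cong) (auto simp: csum_add)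
  have rc: "is_record (q - 1) (seq_shift 1 x) \<longleftrightarrow> (\<forall>k\<in>{1..<q}. csum q x < csum k x)"
    unfolding record_shift_iff using q by simp
  show ?thesis
  proof (intro iffI conjI)
    assume L: "is_record n y \<and> nonneg (n - q) y"
    then show "csum n x < 0" using n q unfolding is_record_def by force
    show "is_record (q - 1) (seq_shift 1 x)" unfolding rc
    proof
      fix k assume k: "k \<in> {1..<q}"
      then have "n - q + k < n" using q by auto
      with L have "csum n y < csum (n - q + k) y" unfolding is_record_def by auto
      then show "csum q x < csum k x" using 2[of k] n k by auto
    qed
    show "nonneg (n - q) (seq_shift q x)" using L nn by simp
  next
    assume R: "csum n x < 0 \<and> is_record (q - 1) (seq_shift 1 x) \<and> nonneg (n - q) (seq_shift q x)"
    then show p: "nonneg (n - q) y" using nn by simp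
    show "is_record n y" unfolding is_record_def
    proof (intro allI impI)
      fix j assume j: "j < n"
      show "csum n y < csum j y"
      \<comment> \<open>On the first stretch the partial sums of \<open>y\<close> are nonnegative,
        hence above the negative endpoint. On the second the claim says that \<open>csum q x\<close>
        lies strictly below \<open>csum k x\<close> for \<open>1 \<le> k < q\<close>.\<close>
      proof (cases "j \<le> n - q")
        case True
        have "0 \<le> csum j y" using p True unfolding stays_above_def by (cases "j = 0") auto
        then show ?thesis using R n by simp
      next
        case False
        define k where "k = j - (n - q)"
        have k: "k \<in> {1..<q}" "j = n - q + k" using False j q by (auto simp: k_def)
        then have "csum q x < csum k x" using R rc by auto
        then show ?thesis using 2[of k] n k by auto
      qed
    qed
  qed
qed

text \<open>Dropping the first increment turns an argmin over \<open>{1..n}\<close> into one over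
  \<open>{0..n - 1}\<close>, to which \<open>ex1_last_record\<close> applies.\<close>

lemma ex1_first_argmin:
  assumes "1 \<le> n"
  shows "\<exists>!q. q \<in> {1..n} \<and> is_record (q - 1) (seq_shift 1 x) \<and> nonneg (n - q) (seq_shift q x)"
proof -
  have ss: "seq_shift j (seq_shift 1 x) = seq_shift (Suc j) x" for j by (simp add: seq_shift_def)
  obtain j where j: "j \<le> n - 1 \<and> is_record j (seq_shift 1 x) \<and> nonneg (n - 1 - j) (seq_shift (Suc j) x)"
    and u: "\<And>i. i \<le> n - 1 \<and> is_record i (seq_shift 1 x) \<and> nonneg (n - 1 - i) (seq_shift (Suc i) x) \<Longrightarrow> i = j"
    using ex1_last_record[of "n - 1" "seq_shift 1 x"] unfolding ss by blast
  show ?thesis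
  proof (rule ex1I[of _ "Suc j"])
    show "Suc j \<in> {1..n} \<and> is_record (Suc j - 1) (seq_shift 1 x) \<and> nonneg (n - Suc j) (seq_shift (Suc j) x)"
      using j assms by auto
  next
    fix q assume q: "q \<in> {1..n} \<and> is_record (q - 1) (seq_shift 1 x) \<and> nonneg (n - q) (seq_shift q x)"
    then obtain i where "q = Suc i" by (cases q) auto
    with q u[of i] show "q = Suc j" by auto
  qed
qed

text \<open>\<open>j\<close> is the \<open>k\<close>-th strict descending ladder epoch, time 0 being
  the 0th. The recursion through the first record matches the induction of
  \<open>suminf_kth_mass_le\<close>, which peels off one ladder height at a time.\<close>

fun kth_record :: "nat \<Rightarrow> nat \<Rightarrow> (nat \<Rightarrow> real) \<Rightarrow> bool" where
  "kth_record 0 j x \<longleftrightarrow> j = 0"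
| "kth_record (Suc k) j x \<longleftrightarrow> (\<exists>i\<in>{1..j}. first_record i x \<and> kth_record k (j - i) (seq_shift i x))"

lemma record_imp_kth_record: "is_record j x \<Longrightarrow> \<exists>k. kth_record k j x"
proof (induction j arbitrary: x rule: less_induct)
  case (less j)
  show ?case
  proof (cases "j = 0")
    case True
    then show ?thesis by (intro exI[of _ 0]) simp
  next
    case False
    then have "csum j x < 0" using less.prems by (auto simp: is_record_def dest: spec[of _ 0])
    then have "\<not> nonneg j x" using False unfolding stays_above_def by (auto intro!: bexI[of _ j])
    then obtain i where i: "i \<in> {1..j}" "first_record i x" by (rule ex_first_record)
    then have "is_record (j - i) (seq_shift i x)"
      using record_add_iff[OF first_record_record[OF i(2)], of "j - i"] less.prems by simp
    then obtain k where "kth_record k (j - i) (seq_shift i x)" using less.IH[of "j - i"] i by auto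
    with i show ?thesis by (intro exI[of _ "Suc k"]) auto
  qed
qed

section \<open>Ladder epoch and ladder height through first records\<close>

lemma first_record_ladder_epoch:
  assumes n: "first_record n x"
  shows "ladder_epoch csum x = enat n"
  unfolding passage_time_def
proof (rule Inf_eqI)
  fix i assume "i \<in> enat ` {n. 1 \<le> n \<and> csum n x < - 0}"
  then obtain k where k: "i = enat k" "1 \<le> k" "csum k x < 0" by auto
  then have "\<not> nonneg k x" unfolding stays_above_def by (auto intro!: bexI[of _ k])
  then have "\<not> k < n" using first_record_nonneg[OF n] by blast
  then show "enat n \<le> i" using k by simp
next
  fix y assume "\<And>i. i \<in> enat ` {n. 1 \<le> n \<and> csum n x < - 0} \<Longrightarrow> y \<le> i"
  then show "y \<le> enat n" using n by (auto simp: first_record_def)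
qed

lemma no_first_record_ladder_epoch:
  assumes "\<And>n. \<not> first_record n x"
  shows "ladder_epoch csum x = \<infinity>"
proof -
  have "{n. 1 \<le> n \<and> csum n x < - 0} = {}"
  proof (rule ccontr)
    assume "{n. 1 \<le> n \<and> csum n x < - 0} \<noteq> {}"
    then obtain k where "1 \<le> k" "csum k x < 0" by auto
    then have "\<not> nonneg k x" unfolding stays_above_def by (auto intro!: bexI[of _ k])
    then show False using assms by (metis ex_first_record)
  qed
  then show ?thesis unfolding passage_time_def by (simp only: image_empty Inf_empty top_enat_def)
qed

lemma ladder_height_csum:
  "ladder_height csum x = (if \<exists>n. first_record n x then - csum (THE n. first_record n x) x else 0)"
proof (cases "\<exists>n. first_record n x")
  case True
  then obtain n where n: "first_record n x" by blast
  then have "(THE n. first_record n x) = n" using first_record_unique by blast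
  with n show ?thesis by (auto simp: ladder_height_def first_record_ladder_epoch)
qed (simp add: ladder_height_def no_first_record_ladder_epoch)

lemma ladder_height_first_record: "first_record n x \<Longrightarrow> ladder_height csum x = - csum n x"
  by (simp add: ladder_height_def first_record_ladder_epoch)

section \<open>Records of the random walk on the product space\<close>

text \<open>On the canonical space of increment sequences, splitting at a fixed time and permuting
  increments act on the sample point itself. The locale serves twice: for the law of an increment
  and for the law of a ladder height.\<close>

locale iid_walk = sequence_space \<mu> for \<mu> :: "real measure" +
  assumes sets_mu: "sets \<mu> = sets borel"
begin

lemma space_mu [simp]: "space \<mu> = UNIV"
  using sets_eq_imp_space_eq[OF sets_mu] by simp

lemma space_S [simp]: "space S = UNIV"
  by (simp add: space_PiM)

lemma measurable_coord [measurable]: "(\<lambda>x. x i) \<in> borel_measurable S"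
proof -
  have "(\<lambda>x. x i) \<in> measurable S \<mu>" by (rule measurable_component_singleton) simp
  then show ?thesis by (simp add: measurable_cong_sets[OF refl sets_mu])
qed

lemma measurable_csum [measurable]: "csum n \<in> borel_measurable S"
  unfolding walk_def by measurable

lemma measurable_seq_shift [measurable]: "seq_shift i \<in> measurable S S"
  unfolding seq_shift_def
  by (rule measurable_PiM_single') (auto intro!: measurable_component_singleton)

lemma pred_is_record [measurable]: "Measurable.pred S (is_record n)"
  unfolding is_record_def by measurable

lemma pred_stays_above [measurable]: "Measurable.pred S (stays_above g n)"
  unfolding stays_above_def by measurable

lemma pred_first_record [measurable]: "Measurable.pred S (first_record n)"
  unfolding first_record_def by measurable

lemma pred_kth_record [measurable]: "Measurable.pred S (kth_record k j)"
proof (induction k arbitrary: j)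
  case (Suc k)
  note Suc [measurable]
  have "kth_record (Suc k) j = (\<lambda>x. \<exists>i\<in>{1..j}. first_record i x \<and> kth_record k (j - i) (seq_shift i x))"
    by (rule ext) simp
  then show ?case by simp
next
  case 0
  have "kth_record 0 j = (\<lambda>x. j = 0)" by (rule ext) simp
  then show ?case by simp
qed

lemma measurable_ladder_epoch [measurable]: "ladder_epoch csum \<in> measurable S (count_space UNIV)"
proof -
  have [measurable]: "(\<lambda>x. THE n. first_record n x) \<in> measurable S (count_space UNIV)"
    by (rule measurable_THE[where I = UNIV]) (auto dest: first_record_unique)
  have "ladder_epoch csum = (\<lambda>x. if \<exists>n. first_record n x then enat (THE n. first_record n x) else \<infinity>)"
  proof
    fix x
    show "ladder_epoch csum x = (if \<exists>n. first_record n x then enat (THE n. first_record n x) else \<infinity>)"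
    proof (cases "\<exists>n. first_record n x")
      case True
      then obtain n where n: "first_record n x" by blast
      then have "(THE n. first_record n x) = n" using first_record_unique by blast
      with n show ?thesis by (auto simp: first_record_ladder_epoch)
    qed (simp add: no_first_record_ladder_epoch)
  qed
  then show ?thesis by simp
qed

lemma measurable_ladder_height [measurable]: "ladder_height csum \<in> borel_measurable S"
proof -
  have [measurable]: "(\<lambda>x. THE n. first_record n x) \<in> measurable S (count_space UNIV)"
    by (rule measurable_THE[where I = UNIV]) (auto dest: first_record_unique)
  have [measurable]: "(\<lambda>x. csum (THE n. first_record n x) x) \<in> borel_measurable S"
    by (rule measurable_compose_countable) measurable
  have "ladder_height csum = (\<lambda>x. if \<exists>n. first_record n x then - csum (THE n. first_record n x) x else 0)"
    by (rule ext) (rule ladder_height_csum)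
  then show ?thesis by simp
qed

text \<open>Two independent samples concatenated at time \<open>i\<close> form again a sample
  (\<open>PiM_comb_seq\<close>), so the future \<open>seq_shift i x\<close> may be replaced by an
  independent \<open>y\<close>. Assumption \<open>dep\<close> says that \<open>R\<close> looks only
  at the first \<open>i\<close> increments of its first argument.\<close>

lemma markov_emeasure:
  assumes R [measurable]: "Measurable.pred (S \<Otimes>\<^sub>M S) (\<lambda>(x, y). R x y)"
    and dep: "\<And>x y z. R (comb_seq i x y) z = R x z"
  shows "emeasure S {x. R x (seq_shift i x)} = (\<integral>\<^sup>+x. emeasure S {y. R x y} \<partial>S)"
    and "(\<lambda>x. emeasure S {y. R x y}) \<in> borel_measurable S"
proof -
  define B where "B = {z. R (fst z) (snd z)}"
  have space2: "space (S \<Otimes>\<^sub>M S) = UNIV" by (simp add: space_pair_measure)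
  have B: "B \<in> sets (S \<Otimes>\<^sub>M S)"
    using R unfolding B_def pred_def space2 by (simp add: case_prod_beta)
  have [measurable]: "Measurable.pred S (\<lambda>x. R x (seq_shift i x))"
  proof -
    have "(\<lambda>x. (x, seq_shift i x)) \<in> measurable S (S \<Otimes>\<^sub>M S)" by measurable
    from measurable_compose[OF this R] show ?thesis by simp
  qed
  have sec: "Pair x -` B = {y. R x y}" for x by (auto simp: B_def)
  have "emeasure S {x. R x (seq_shift i x)} =
      emeasure (distr (S \<Otimes>\<^sub>M S) S (\<lambda>(x, y). comb_seq i x y)) {x. R x (seq_shift i x)}"
    by (simp only: PiM_comb_seq)
  also have "\<dots> = emeasure (S \<Otimes>\<^sub>M S) ((\<lambda>(x, y). comb_seq i x y) -` {x. R x (seq_shift i x)} \<inter> space (S \<Otimes>\<^sub>M S))"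
  proof (rule emeasure_distr[OF measurable_comb_seq])
    have "Measurable.pred S (\<lambda>x. R x (seq_shift i x))" by measurable
    then show "{x. R x (seq_shift i x)} \<in> sets S" unfolding pred_def by simp
  qed
  also have "(\<lambda>(x, y). comb_seq i x y) -` {x. R x (seq_shift i x)} \<inter> space (S \<Otimes>\<^sub>M S) = B"
    by (auto simp: B_def space2 dep shift_comb_seq)
  also have "emeasure (S \<Otimes>\<^sub>M S) B = (\<integral>\<^sup>+x. emeasure S {y. R x y} \<partial>S)"
    by (simp only: P.emeasure_pair_measure_alt[OF B] sec)
  finally show "emeasure S {x. R x (seq_shift i x)} = (\<integral>\<^sup>+x. emeasure S {y. R x y} \<partial>S)" .
  show "(\<lambda>x. emeasure S {y. R x y}) \<in> borel_measurable S"
    using P.measurable_emeasure_Pair[OF B] by (simp only: sec)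
qed

lemma sets_Collect_S: "Measurable.pred S Q \<Longrightarrow> {x. Q x} \<in> sets S"
  by (simp add: pred_def)

lemma markov_prob:
  assumes [measurable]: "Measurable.pred S Q" "Measurable.pred S R"
    and dep: "\<And>x y. Q (comb_seq i x y) = Q x"
  shows "P.prob {x. Q x \<and> R (seq_shift i x)} = P.prob {x. Q x} * P.prob {x. R x}"
proof -
  have "emeasure S {x. Q x \<and> R (seq_shift i x)} = (\<integral>\<^sup>+x. emeasure S {y. Q x \<and> R y} \<partial>S)"
    by (rule markov_emeasure) (auto simp: dep)
  also have "\<dots> = (\<integral>\<^sup>+x. emeasure S {y. R y} * indicator {x. Q x} x \<partial>S)"
    by (intro nn_integral_cong) (auto split: split_indicator)
  also have "\<dots> = emeasure S {y. R y} * emeasure S {x. Q x}"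
    by (rule nn_integral_cmult_indicator) (rule sets_Collect_S, measurable)
  finally show ?thesis by (simp add: measure_def enn2real_mult mult.commute)
qed

text \<open>Exchangeability: distinct coordinates of an i.i.d. sequence, taken in any order, form an
  i.i.d. sequence of the same law.\<close>

lemma prob_permute:
  assumes [measurable]: "Measurable.pred S Q" and \<pi>: "inj \<pi>"
  shows "P.prob {x. Q (\<lambda>k. x (\<pi> k))} = P.prob {x. Q x}"
proof -
  have "distr S S (\<lambda>x. \<lambda>k\<in>UNIV. x (\<pi> k)) = S"
    by (rule distr_PiM_reindex[of UNIV "\<lambda>_. \<mu>" \<pi> UNIV]) (auto simp: \<pi> M.prob_space_axioms)
  then have d: "distr S S (\<lambda>x k. x (\<pi> k)) = S" by (simp add: restrict_def)
  have m: "(\<lambda>x k. x (\<pi> k)) \<in> measurable S S"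
    by (rule measurable_PiM_single') (auto intro!: measurable_component_singleton)
  have "P.prob {x. Q x} = measure (distr S S (\<lambda>x k. x (\<pi> k))) {x. Q x}" by (simp only: d)
  also have "\<dots> = P.prob ((\<lambda>x k. x (\<pi> k)) -` {x. Q x} \<inter> space S)"
    by (rule measure_distr[OF m]) (rule sets_Collect_S, measurable)
  finally show ?thesis by (simp add: vimage_def)
qed

lemma prob_partition:
  assumes "finite I" and [measurable]: "\<And>i. i \<in> I \<Longrightarrow> Measurable.pred S (E i)"
    and "\<And>x. Q x \<longleftrightarrow> (\<exists>i\<in>I. E i x)"
    and "\<And>i j x. i \<in> I \<Longrightarrow> j \<in> I \<Longrightarrow> E i x \<Longrightarrow> E j x \<Longrightarrow> i = j"
  shows "P.prob {x. Q x} = (\<Sum>i\<in>I. P.prob {x. E i x})"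
proof -
  have "{x. Q x} = (\<Union>i\<in>I. {x. E i x})" using assms(3) by auto
  also have "P.prob \<dots> = (\<Sum>i\<in>I. P.prob {x. E i x})"
    using assms(1,2,4) by (intro P.finite_measure_finite_Union)
      (auto simp: disjoint_family_on_def intro!: sets_Collect_S)
  finally show ?thesis .
qed

section \<open>The tail \<open>a n = P(T_0 > n)\<close> and decompositions at records\<close>

definition tail :: "nat \<Rightarrow> real" where
  "tail n = P.prob {x. nonneg n x}"

lemma tail_0: "tail 0 = 1"
  using P.prob_space by (simp add: tail_def stays_above_def)

lemma tail_nonneg: "0 \<le> tail n"
  by (simp add: tail_def)

lemma decseq_prob_stays_above: "decseq (\<lambda>n. P.prob {x. stays_above g n x})"
  by (intro decseq_SucI P.finite_measure_mono sets_Collect_S pred_stays_above) (auto simp: stays_above_def)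

lemma decseq_tail: "decseq tail"
  unfolding tail_def by (rule decseq_prob_stays_above)

lemma prob_first_record:
  assumes "1 \<le> k"
  shows "P.prob {x. first_record k x} = tail (k - 1) - tail k"
proof -
  have atk: "{1..k} = insert k {1..k - 1}" using assms by auto
  have "{x. first_record k x} = {x. nonneg (k - 1) x} - {x. nonneg k x}"
    using assms unfolding first_record_def stays_above_def atk by (auto simp: not_le)
  moreover have "{x. nonneg k x} \<subseteq> {x. nonneg (k - 1) x}" unfolding stays_above_def by auto
  ultimately show ?thesis unfolding tail_def
    by (simp add: P.finite_measure_Diff sets_Collect_S)
qed

text \<open>The last record \<open>j\<close> up to \<open>n\<close> separates a past from an
  independent future that stays nonnegative. The third assumption lets the event at time
  \<open>n\<close> be decided at time \<open>j\<close>. The trivial event yields the renewal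
  identity between records and \<open>tail\<close>; \<open>stays_above g\<close> yields the
  convolution for \<open>P(T_g > n)\<close>.\<close>

lemma last_record_decomposition:
  assumes [measurable]: "\<And>j. Measurable.pred S (Q j)"
    and dep: "\<And>j x y. Q j (comb_seq j x y) = Q j x"
    and Q: "\<And>j x. j \<le> n \<Longrightarrow> nonneg (n - j) (seq_shift j x) \<Longrightarrow> Q n x = Q j x"
  shows "P.prob {x. Q n x} = (\<Sum>j\<le>n. P.prob {x. is_record j x \<and> Q j x} * tail (n - j))"
proof -
  have "P.prob {x. Q n x} = (\<Sum>j\<le>n. P.prob {x. (is_record j x \<and> Q j x) \<and> nonneg (n - j) (seq_shift j x)})"
  proof (rule prob_partition)
    fix x show "Q n x \<longleftrightarrow> (\<exists>j\<in>{..n}. (is_record j x \<and> Q j x) \<and> nonneg (n - j) (seq_shift j x))"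
    proof -
      obtain j where "j \<le> n" "is_record j x" "nonneg (n - j) (seq_shift j x)"
        using ex1_last_record[of n x] by blast
      then show ?thesis using Q by auto
    qed
  next
    fix i j x assume "i \<in> {..n}" "j \<in> {..n}"
      "(is_record i x \<and> Q i x) \<and> nonneg (n - i) (seq_shift i x)"
      "(is_record j x \<and> Q j x) \<and> nonneg (n - j) (seq_shift j x)"
    then show "i = j" using ex1_last_record[of n x] by auto
  qed (simp, measurable)
  also have "\<dots> = (\<Sum>j\<le>n. P.prob {x. is_record j x \<and> Q j x} * tail (n - j))"
    unfolding tail_def
    by (intro sum.cong refl markov_prob) (measurable, auto simp: record_comb_seq dep)
  finally show ?thesis .
qed

lemma prob_csum_neg:
  assumes n: "1 \<le> n"
  shows "P.prob {x. csum n x < 0} = (\<Sum>i<n. P.prob {x. is_record n x \<and> nonneg i x})"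
proof -
  have "P.prob {x. csum n x < 0} = (\<Sum>q\<in>{1..n}.
      P.prob {x. csum n x < 0 \<and> is_record (q - 1) (seq_shift 1 x) \<and> nonneg (n - q) (seq_shift q x)})"
  proof (rule prob_partition)
    fix x show "csum n x < 0 \<longleftrightarrow>
      (\<exists>q\<in>{1..n}. csum n x < 0 \<and> is_record (q - 1) (seq_shift 1 x) \<and> nonneg (n - q) (seq_shift q x))"
      using ex1_first_argmin[OF n, of x] by blast
  next
    fix p q x assume "p \<in> {1..n}" "q \<in> {1..n}"
      "csum n x < 0 \<and> is_record (p - 1) (seq_shift 1 x) \<and> nonneg (n - p) (seq_shift p x)"
      "csum n x < 0 \<and> is_record (q - 1) (seq_shift 1 x) \<and> nonneg (n - q) (seq_shift q x)"
    then show "p = q" using ex1_first_argmin[OF n, of x] by blast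
  qed (simp, measurable)
  also have "\<dots> = (\<Sum>q\<in>{1..n}. P.prob {x. is_record n x \<and> nonneg (n - q) x})"
  proof (rule sum.cong[OF refl])
    fix q assume q: "q \<in> {1..n}"
    \<comment> \<open>The rotation of \<open>first_argmin_rotate\<close>, extended by the identity
      from \<open>n\<close> on.\<close>
    define \<pi> where "\<pi> j = (if j < n - q then q + j else if j < n then j - (n - q) else j)" for j
    have inj: "inj \<pi>" unfolding inj_def \<pi>_def using q by auto
    have "P.prob {x. is_record n x \<and> nonneg (n - q) x} =
        P.prob {x. is_record n (\<lambda>k. x (\<pi> k)) \<and> nonneg (n - q) (\<lambda>k. x (\<pi> k))}"
      by (rule prob_permute[symmetric, OF _ inj]) measurable
    also have "(\<lambda>x. is_record n (\<lambda>k. x (\<pi> k)) \<and> nonneg (n - q) (\<lambda>k. x (\<pi> k))) =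
        (\<lambda>x. csum n x < 0 \<and> is_record (q - 1) (seq_shift 1 x) \<and> nonneg (n - q) (seq_shift q x))"
      by (rule ext, rule first_argmin_rotate) (use q in \<open>auto simp: \<pi>_def\<close>)
    finally show "P.prob {x. csum n x < 0 \<and> is_record (q - 1) (seq_shift 1 x) \<and> nonneg (n - q) (seq_shift q x)} =
      P.prob {x. is_record n x \<and> nonneg (n - q) x}" by simp
  qed
  also have "\<dots> = (\<Sum>i<n. P.prob {x. is_record n x \<and> nonneg i x})"
    by (rule sum.reindex_bij_witness[of _ "\<lambda>i. n - i" "\<lambda>q. n - q"]) auto
  finally show ?thesis .
qed

text \<open>Split at the first record \<open>k\<close>: \<open>nonneg i\<close> amounts to
  \<open>k > i\<close>, and beyond \<open>k\<close> the walk regenerates.\<close>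

lemma prob_record_nonneg:
  assumes "i < n"
  shows "P.prob {x. is_record n x \<and> nonneg i x} =
    (\<Sum>k\<in>{i<..n}. (tail (k - 1) - tail k) * P.prob {x. is_record (n - k) x})"
proof -
  have "P.prob {x. is_record n x \<and> nonneg i x} =
    (\<Sum>k\<in>{i<..n}. P.prob {x. first_record k x \<and> is_record (n - k) (seq_shift k x)})"
  proof (rule prob_partition)
    fix x
    show "(is_record n x \<and> nonneg i x) \<longleftrightarrow>
      (\<exists>k\<in>{i<..n}. first_record k x \<and> is_record (n - k) (seq_shift k x))"
    proof
      assume L: "is_record n x \<and> nonneg i x"
      then have "csum n x < 0" using assms by (auto simp: is_record_def dest: spec[of _ 0])
      then have "\<not> nonneg n x" using assms unfolding stays_above_def by (auto intro!: bexI[of _ n])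
      then obtain k where k: "k \<in> {1..n}" "first_record k x" by (rule ex_first_record)
      with L have "i < k" using first_record_not_nonneg[of k x i] by (meson not_less)
      moreover have "is_record (n - k) (seq_shift k x)"
        using record_add_iff[OF first_record_record[OF k(2)], of "n - k"] L k by simp
      ultimately show "\<exists>k\<in>{i<..n}. first_record k x \<and> is_record (n - k) (seq_shift k x)"
        using k by auto
    next
      assume "\<exists>k\<in>{i<..n}. first_record k x \<and> is_record (n - k) (seq_shift k x)"
      then obtain k where k: "i < k" "k \<le> n" "first_record k x" "is_record (n - k) (seq_shift k x)" by auto
      then show "is_record n x \<and> nonneg i x"
        using record_add_iff[OF first_record_record[OF k(3)], of "n - k"] first_record_nonneg by simp
    qed
  next
    fix k l x assume "first_record k x \<and> is_record (n - k) (seq_shift k x)"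
      "first_record l x \<and> is_record (n - l) (seq_shift l x)"
    then show "k = l" using first_record_unique by blast
  qed (simp, measurable)
  also have "\<dots> = (\<Sum>k\<in>{i<..n}. P.prob {x. first_record k x} * P.prob {x. is_record (n - k) x})"
    by (intro sum.cong refl markov_prob) (measurable, auto simp: first_record_comb_seq)
  also have "\<dots> = (\<Sum>k\<in>{i<..n}. (tail (k - 1) - tail k) * P.prob {x. is_record (n - k) x})"
    by (intro sum.cong refl) (simp add: prob_first_record)
  finally show ?thesis .
qed

text \<open>Markov property at the next record \<open>i\<close> after \<open>n\<close>: from there
  on the records are those of the restarted walk. The level at \<open>i\<close> is not positive, so
  depth at most \<open>z\<close> below 0 implies depth at most \<open>z\<close> below that level.
  Given the past, the expected number of such records is therefore at most \<open>K\<close>.\<close>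

lemma sum_records_after_le:
  assumes [measurable]: "Measurable.pred S Q" and dep: "\<And>x y m. n \<le> m \<Longrightarrow> Q (comb_seq m x y) = Q x"
    and K: "\<And>M. (\<Sum>m\<le>M. P.prob {x. is_record m x \<and> - csum m x \<le> z}) \<le> K"
  shows "(\<Sum>j\<in>{n<..N}. P.prob {x. Q x \<and> is_record j x \<and> - csum j x \<le> z}) \<le> P.prob {x. Q x} * K"
proof -
  \<comment> \<open>For \<open>i > n\<close> this says that the next record after \<open>n\<close>
    occurs at \<open>i\<close>; these events are disjoint.\<close>
  define nr where "nr i x \<longleftrightarrow> is_record i x \<and> (\<forall>l\<in>{n<..<i}. \<not> is_record l x)" for i x
  have [measurable]: "Measurable.pred S (nr i)" for i unfolding nr_def by measurable
  have dep_nr: "nr i (comb_seq i x y) = nr i x" for i x y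
    unfolding nr_def by (simp add: record_comb_seq)
  define v where "v m = P.prob {x. is_record m x \<and> - csum m x \<le> z}" for m
  have K0: "0 \<le> K" using K[of 0] by (rule order_trans[rotated]) (auto intro!: sum_nonneg)
  have step: "P.prob {x. Q x \<and> is_record j x \<and> - csum j x \<le> z} \<le>
    (\<Sum>i\<in>{n<..j}. P.prob {x. Q x \<and> nr i x} * v (j - i))" if "n < j" for j
  proof -
    have "P.prob {x. Q x \<and> is_record j x \<and> - csum j x \<le> z} \<le> P.prob (\<Union>i\<in>{n<..j}.
        {x. (Q x \<and> nr i x) \<and> is_record (j - i) (seq_shift i x) \<and> - csum (j - i) (seq_shift i x) \<le> z})"
    proof (rule P.finite_measure_mono)
      show "{x. Q x \<and> is_record j x \<and> - csum j x \<le> z} \<subseteq> (\<Union>i\<in>{n<..j}.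
        {x. (Q x \<and> nr i x) \<and> is_record (j - i) (seq_shift i x) \<and> - csum (j - i) (seq_shift i x) \<le> z})"
      proof
        fix x assume "x \<in> {x. Q x \<and> is_record j x \<and> - csum j x \<le> z}"
        then have x: "Q x" "is_record j x" "- csum j x \<le> z" by auto
        define i where "i = (LEAST i. n < i \<and> is_record i x)"
        have i: "n < i \<and> is_record i x" unfolding i_def
          by (rule LeastI[of "\<lambda>i. n < i \<and> is_record i x" j]) (use that x in simp)
        have ij: "i \<le> j" unfolding i_def using that x by (simp add: Least_le)
        have "\<not> is_record l x" if "l \<in> {n<..<i}" for l
          using that not_less_Least[of l "\<lambda>i. n < i \<and> is_record i x"] unfolding i_def by auto
        then have nr: "nr i x" using i by (simp add: nr_def)
        have "is_record (j - i) (seq_shift i x)" using record_add_iff[of i x "j - i"] i ij x by simp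
        moreover have "- csum (j - i) (seq_shift i x) \<le> z"
          using csum_shift[OF ij, of x] record_nonpos[of i x] i x by simp
        ultimately show "x \<in> (\<Union>i\<in>{n<..j}. {x. (Q x \<and> nr i x) \<and> is_record (j - i) (seq_shift i x) \<and>
            - csum (j - i) (seq_shift i x) \<le> z})"
          using i ij nr x by auto
      qed
    qed (auto intro!: sets.finite_UN sets_Collect_S)
    also have "\<dots> \<le> (\<Sum>i\<in>{n<..j}. P.prob
        {x. (Q x \<and> nr i x) \<and> is_record (j - i) (seq_shift i x) \<and> - csum (j - i) (seq_shift i x) \<le> z})"
      by (rule P.finite_measure_subadditive_finite) (auto intro!: sets_Collect_S)
    also have "\<dots> = (\<Sum>i\<in>{n<..j}. P.prob {x. Q x \<and> nr i x} * v (j - i))"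
      unfolding v_def
      by (intro sum.cong refl markov_prob) (measurable, auto simp: dep dep_nr)
    finally show ?thesis .
  qed
  have "(\<Sum>j\<in>{n<..N}. P.prob {x. Q x \<and> is_record j x \<and> - csum j x \<le> z}) \<le>
      (\<Sum>j\<in>{n<..N}. \<Sum>i\<in>{n<..j}. P.prob {x. Q x \<and> nr i x} * v (j - i))"
    by (intro sum_mono step) auto
  also have "\<dots> = (\<Sum>j\<in>{n<..N}. \<Sum>i\<in>{n<..N}. if i \<le> j then P.prob {x. Q x \<and> nr i x} * v (j - i) else 0)"
    by (intro sum.cong[OF refl] sum.mono_neutral_cong_left) auto
  also have "\<dots> = (\<Sum>i\<in>{n<..N}. \<Sum>j\<in>{n<..N}. if i \<le> j then P.prob {x. Q x \<and> nr i x} * v (j - i) else 0)"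
    by (rule sum.swap)
  also have "\<dots> \<le> (\<Sum>i\<in>{n<..N}. P.prob {x. Q x \<and> nr i x} * K)"
  proof (rule sum_mono)
    fix i assume i: "i \<in> {n<..N}"
    have "(\<Sum>j\<in>{n<..N}. if i \<le> j then P.prob {x. Q x \<and> nr i x} * v (j - i) else 0) =
        (\<Sum>j\<in>{i..N}. P.prob {x. Q x \<and> nr i x} * v (j - i))"
      using i by (intro sum.mono_neutral_cong_right) auto
    also have "\<dots> = (\<Sum>m\<le>N - i. P.prob {x. Q x \<and> nr i x} * v m)"
      using i by (intro sum.reindex_bij_witness[of _ "\<lambda>m. m + i" "\<lambda>j. j - i"]) auto
    also have "\<dots> = P.prob {x. Q x \<and> nr i x} * (\<Sum>m\<le>N - i. v m)"
      by (rule sum_distrib_left[symmetric])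
    also have "\<dots> \<le> P.prob {x. Q x \<and> nr i x} * K"
      unfolding v_def by (intro mult_left_mono K) auto
    finally show "(\<Sum>j\<in>{n<..N}. if i \<le> j then P.prob {x. Q x \<and> nr i x} * v (j - i) else 0) \<le>
      P.prob {x. Q x \<and> nr i x} * K" .
  qed
  also have "\<dots> = P.prob {x. \<exists>i\<in>{n<..N}. Q x \<and> nr i x} * K"
  proof -
    have "P.prob {x. \<exists>i\<in>{n<..N}. Q x \<and> nr i x} = (\<Sum>i\<in>{n<..N}. P.prob {x. Q x \<and> nr i x})"
    proof (rule prob_partition)
      fix i j x assume "i \<in> {n<..N}" "j \<in> {n<..N}" "Q x \<and> nr i x" "Q x \<and> nr j x"
      then show "i = j" unfolding nr_def by (metis greaterThanAtMost_iff greaterThanLessThan_iff linorder_neqE_nat)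
    qed (simp, measurable)
    then show ?thesis by (simp add: sum_distrib_right)
  qed
  also have "\<dots> \<le> P.prob {x. Q x} * K"
    using K0 by (intro mult_right_mono P.finite_measure_mono) (auto intro!: sets_Collect_S)
  finally show ?thesis .
qed

end

section \<open>Record heights and the renewal function\<close>

lemma suminf_shift_le:
  fixes f :: "nat \<Rightarrow> ennreal"
  shows "(\<Sum>j. if i \<le> j then f (j - i) else 0) \<le> suminf f"
  unfolding suminf_eq_SUP[of "\<lambda>j. if i \<le> j then f (j - i) else 0"]
proof (rule SUP_least)
  fix n
  have "(\<Sum>j<n. if i \<le> j then f (j - i) else 0) = (\<Sum>j\<in>{i..<n}. f (j - i))"
    by (intro sum.mono_neutral_cong_right) auto
  also have "\<dots> = (\<Sum>m<n - i. f m)"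
    by (rule sum.reindex_bij_witness[of _ "\<lambda>m. m + i" "\<lambda>j. j - i"]) auto
  also have "\<dots> \<le> suminf f" by (rule sum_le_suminf) auto
  finally show "(\<Sum>j<n. if i \<le> j then f (j - i) else 0) \<le> suminf f" .
qed

lemma suminf_swap_ennreal:
  fixes f :: "nat \<Rightarrow> nat \<Rightarrow> ennreal"
  shows "(\<Sum>i. \<Sum>j. f i j) = (\<Sum>j. \<Sum>i. f i j)"
  using nn_integral_suminf[of "\<lambda>j i. f i j" "count_space UNIV"]
  by (simp add: nn_integral_count_space_nat)

context iid_walk
begin

text \<open>Summed over \<open>j\<close>, this is the probability that a \<open>k\<close>-th record
  exists and has depth at most \<open>z\<close>.\<close>

definition kth_mass :: "nat \<Rightarrow> nat \<Rightarrow> real \<Rightarrow> ennreal" where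
  "kth_mass k j z = emeasure S {x. kth_record k j x \<and> - csum j x \<le> z}"

text \<open>\<open>ladder_height csum x\<close> stands in for \<open>- csum i x\<close>, with which
  it agrees on the event. The epoch \<open>i\<close> then enters the integrand only through
  \<open>first_record i x\<close>, which allows the summation over \<open>i\<close> in
  \<open>suminf_kth_mass_Suc\<close>.\<close>

lemma markov_kth_mass:
  shows "emeasure S {x. first_record i x \<and> kth_record k m (seq_shift i x) \<and> - csum (i + m) x \<le> z} =
      (\<integral>\<^sup>+x. (if first_record i x then kth_mass k m (z - ladder_height csum x) else 0) \<partial>S)"
    and "(\<lambda>x. if first_record i x then kth_mass k m (z - ladder_height csum x) else 0) \<in> borel_measurable S"
proof -
  define R where "R x y \<longleftrightarrow> first_record i x \<and> kth_record k m y \<and> - csum i x - csum m y \<le> z" for x y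
  have R: "Measurable.pred (S \<Otimes>\<^sub>M S) (\<lambda>(x, y). R x y)" unfolding R_def by measurable
  have dep: "R (comb_seq i x y) w = R x w" for x y w
    unfolding R_def by (simp add: first_record_comb_seq csum_comb_seq)
  have eq: "emeasure S {y. R x y} = (if first_record i x then kth_mass k m (z - ladder_height csum x) else 0)" for x
  proof (cases "first_record i x")
    case True
    then have "{y. R x y} = {y. kth_record k m y \<and> - csum m y \<le> z - ladder_height csum x}"
      unfolding R_def ladder_height_first_record[OF True] by auto
    with True show ?thesis by (simp add: kth_mass_def)
  qed (simp add: R_def)
  have "{x. first_record i x \<and> kth_record k m (seq_shift i x) \<and> - csum (i + m) x \<le> z} = {x. R x (seq_shift i x)}"
    unfolding R_def csum_add by (auto simp: algebra_simps)
  then show "emeasure S {x. first_record i x \<and> kth_record k m (seq_shift i x) \<and> - csum (i + m) x \<le> z} =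
      (\<integral>\<^sup>+x. (if first_record i x then kth_mass k m (z - ladder_height csum x) else 0) \<partial>S)"
    by (simp only: markov_emeasure(1)[OF R dep] eq)
  show "(\<lambda>x. if first_record i x then kth_mass k m (z - ladder_height csum x) else 0) \<in> borel_measurable S"
    using markov_emeasure(2)[OF R dep] by (simp only: eq)
qed

text \<open>At most one \<open>i\<close> satisfies \<open>first_record i x\<close>, so for fixed
  \<open>x\<close> the double sum collapses to a single series shifted by that
  \<open>i\<close>.\<close>

lemma suminf_kth_mass_Suc:
  "(\<Sum>j. kth_mass (Suc k) j z) \<le> (\<integral>\<^sup>+x. (\<Sum>j. kth_mass k j (z - ladder_height csum x)) \<partial>S)"
proof -
  define G where "G i m x = (if first_record i x then kth_mass k m (z - ladder_height csum x) else 0)" for i m x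
  have G [measurable]: "G i m \<in> borel_measurable S" for i m
    unfolding G_def by (rule markov_kth_mass(2))
  have "kth_mass (Suc k) j z \<le> (\<integral>\<^sup>+x. (\<Sum>i\<in>{1..j}. G i (j - i) x) \<partial>S)" for j
  proof -
    have "{x. kth_record (Suc k) j x \<and> - csum j x \<le> z} \<subseteq> (\<Union>i\<in>{1..j}.
        {x. first_record i x \<and> kth_record k (j - i) (seq_shift i x) \<and> - csum (i + (j - i)) x \<le> z})"
      by auto
    then have "kth_mass (Suc k) j z \<le> emeasure S (\<Union>i\<in>{1..j}.
        {x. first_record i x \<and> kth_record k (j - i) (seq_shift i x) \<and> - csum (i + (j - i)) x \<le> z})"
      unfolding kth_mass_def by (rule emeasure_mono) (auto intro!: sets.finite_UN sets_Collect_S)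
    also have "\<dots> \<le> (\<Sum>i\<in>{1..j}. emeasure S
        {x. first_record i x \<and> kth_record k (j - i) (seq_shift i x) \<and> - csum (i + (j - i)) x \<le> z})"
      by (rule emeasure_subadditive_finite) (auto intro!: sets_Collect_S)
    also have "\<dots> = (\<Sum>i\<in>{1..j}. \<integral>\<^sup>+x. G i (j - i) x \<partial>S)"
      unfolding markov_kth_mass(1) G_def ..
    also have "\<dots> = (\<integral>\<^sup>+x. (\<Sum>i\<in>{1..j}. G i (j - i) x) \<partial>S)"
      by (rule nn_integral_sum[symmetric]) simp
    finally show ?thesis .
  qed
  then have "(\<Sum>j. kth_mass (Suc k) j z) \<le> (\<Sum>j. \<integral>\<^sup>+x. (\<Sum>i\<in>{1..j}. G i (j - i) x) \<partial>S)"
    by (intro suminf_le) auto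
  also have "\<dots> = (\<integral>\<^sup>+x. (\<Sum>j. \<Sum>i\<in>{1..j}. G i (j - i) x) \<partial>S)"
    by (rule nn_integral_suminf[symmetric]) measurable
  also have "\<dots> \<le> (\<integral>\<^sup>+x. (\<Sum>j. kth_mass k j (z - ladder_height csum x)) \<partial>S)"
  proof (rule nn_integral_mono)
    fix x
    show "(\<Sum>j. \<Sum>i\<in>{1..j}. G i (j - i) x) \<le> (\<Sum>j. kth_mass k j (z - ladder_height csum x))"
    proof (cases "\<exists>i. first_record i x")
      case True
      then obtain i where i: "first_record i x" by blast
      have "(\<Sum>l\<in>{1..j}. G l (j - l) x) = (if i \<le> j then kth_mass k (j - i) (z - ladder_height csum x) else 0)" for j
      proof -
        have "first_record l x \<longleftrightarrow> l = i" for l using i first_record_unique by blast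
        then have "(\<Sum>l\<in>{1..j}. G l (j - l) x) =
            (\<Sum>l\<in>{1..j}. if l = i then kth_mass k (j - l) (z - ladder_height csum x) else 0)"
          by (intro sum.cong) (simp_all add: G_def)
        also have "\<dots> = (if i \<le> j then kth_mass k (j - i) (z - ladder_height csum x) else 0)"
          using i by (auto simp: first_record_def)
        finally show ?thesis .
      qed
      then show ?thesis by (simp only: suminf_shift_le[of i "\<lambda>m. kth_mass k m (z - ladder_height csum x)"])
    qed (simp add: G_def)
  qed
  finally show ?thesis .
qed

text \<open>Induction on \<open>k\<close>: the first ladder height splits off on the left, the first
  coordinate on the right, and both leave the same problem with \<open>z\<close> lowered by that
  amount.\<close>

lemma suminf_kth_mass_le:
  fixes z :: real
  defines "\<nu> \<equiv> distr S borel (ladder_height csum)"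
  shows "(\<Sum>j. kth_mass k j z) \<le> emeasure (Pi\<^sub>M UNIV (\<lambda>_::nat. \<nu>)) {c. csum k c \<le> z}"
proof -
  interpret N: prob_space \<nu> unfolding \<nu>_def by (rule P.prob_space_distr) measurable
  interpret N: iid_walk \<nu>
    by (unfold_locales) (simp_all add: \<nu>_def)
  show ?thesis
  proof (induction k arbitrary: z)
    case 0
    have "(\<Sum>j. kth_mass 0 j z) = (\<Sum>j. if j = 0 then kth_mass 0 0 z else 0)"
      by (intro suminf_cong) (simp add: kth_mass_def)
    also have "\<dots> = kth_mass 0 0 z" 
      using sums_single[of 0 "\<lambda>_. kth_mass 0 0 z"] by (simp add: sums_iff)
    finally show ?case
      using P.emeasure_space_1 N.P.emeasure_space_1 by (cases "0 \<le> z") (simp_all add: kth_mass_def)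
  next
    case (Suc k)
    define G where "G y = emeasure N.S {c. csum k c \<le> z - y}" for y
    define R where "R c d \<longleftrightarrow> c 0 + csum k d \<le> z" for c d :: "nat \<Rightarrow> real"
    have R: "Measurable.pred (N.S \<Otimes>\<^sub>M N.S) (\<lambda>(x, y). R x y)" unfolding R_def by measurable
    have dep: "R (comb_seq 1 x y) w = R x w" for x y w
      unfolding R_def by (simp add: comb_seq_less)
    have GR: "emeasure N.S {d. R c d} = G (c 0)" for c
      unfolding G_def R_def by (intro arg_cong[where f = "emeasure N.S"]) auto
    have G [measurable]: "G \<in> borel_measurable borel"
    proof -
      have "Measurable.pred (borel \<Otimes>\<^sub>M N.S) (\<lambda>p. csum k (snd p) \<le> z - fst p)" by measurable
      then have B: "{p. csum k (snd p) \<le> z - fst p} \<in> sets (borel \<Otimes>\<^sub>M N.S)"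
        by (simp add: pred_def space_pair_measure)
      have G_eq: "G = (\<lambda>y. emeasure N.S (Pair y -` {p. csum k (snd p) \<le> z - fst p}))"
        by (rule ext) (simp add: G_def vimage_def)
      show ?thesis unfolding G_eq by (rule N.P.measurable_emeasure_Pair[OF B])
    qed
    have "(\<Sum>j. kth_mass (Suc k) j z) \<le> (\<integral>\<^sup>+x. (\<Sum>j. kth_mass k j (z - ladder_height csum x)) \<partial>S)"
      by (rule suminf_kth_mass_Suc)
    also have "\<dots> \<le> (\<integral>\<^sup>+x. G (ladder_height csum x) \<partial>S)"
      unfolding G_def by (intro nn_integral_mono Suc)
    also have "\<dots> = (\<integral>\<^sup>+y. G y \<partial>\<nu>)"
      unfolding \<nu>_def by (rule nn_integral_distr[symmetric, OF measurable_ladder_height]) (use G in simp)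
    also have "\<dots> = (\<integral>\<^sup>+c. G (c 0) \<partial>N.S)"
    proof -
      have comp: "distr N.S \<nu> (\<lambda>c. c 0) = \<nu>" by (rule N.PiM_component) simp
      have "G \<in> borel_measurable \<nu>" using G measurable_cong_sets[OF N.sets_mu refl] by blast
      then have "(\<integral>\<^sup>+y. G y \<partial>distr N.S \<nu> (\<lambda>c. c 0)) = (\<integral>\<^sup>+c. G (c 0) \<partial>N.S)"
        by (intro nn_integral_distr measurable_component_singleton) (simp_all only: comp UNIV_I)
      then show ?thesis by (simp only: comp)
    qed
    also have "\<dots> = emeasure N.S {c. R c (seq_shift 1 c)}"
      by (simp only: N.markov_emeasure(1)[OF R dep] GR)
    also have "{c. R c (seq_shift 1 c)} = {c. csum (Suc k) c \<le> z}"
      using csum_add[of 1 k] by (auto simp: R_def walk_def)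
    finally show ?case .
  qed
qed

text \<open>An inequality suffices, so the convention \<open>ladder_height = 0\<close> on \<open>ladder_epoch = \<infinity>\<close> does no harm:
  it can only increase the right-hand side.\<close>

lemma suminf_record_le_renewal:
  fixes M :: "'a measure" and T :: "nat \<Rightarrow> 'a \<Rightarrow> real"
  assumes "distr M borel (ladder_height T) = distr S borel (ladder_height csum)"
  shows "(\<Sum>j. emeasure S {x. is_record j x \<and> - csum j x \<le> z}) \<le> renewal_fun M T z"
proof -
  define \<nu> where "\<nu> = distr S borel (ladder_height csum)"
  define N where "N = Pi\<^sub>M UNIV (\<lambda>_::nat. \<nu>)"
  interpret N: prob_space \<nu> unfolding \<nu>_def by (rule P.prob_space_distr) measurable
  interpret N: iid_walk \<nu>
    by (unfold_locales) (simp_all add: \<nu>_def)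
  have "emeasure S {x. is_record j x \<and> - csum j x \<le> z} \<le> (\<Sum>k. kth_mass k j z)" for j
  proof -
    have "emeasure S {x. is_record j x \<and> - csum j x \<le> z} \<le>
        emeasure S (\<Union>k. {x. kth_record k j x \<and> - csum j x \<le> z})"
      by (intro emeasure_mono) (use record_imp_kth_record in \<open>auto intro!: sets.countable_UN' sets_Collect_S\<close>)
    also have "\<dots> \<le> (\<Sum>k. kth_mass k j z)"
      unfolding kth_mass_def by (intro emeasure_subadditive_countably) (auto intro!: sets_Collect_S)
    finally show ?thesis .
  qed
  then have "(\<Sum>j. emeasure S {x. is_record j x \<and> - csum j x \<le> z}) \<le> (\<Sum>j. \<Sum>k. kth_mass k j z)"
    by (intro suminf_le) auto
  also have "\<dots> = (\<Sum>k. \<Sum>j. kth_mass k j z)" by (rule suminf_swap_ennreal)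
  also have "\<dots> \<le> (\<Sum>k. emeasure N {c. csum k c \<le> z})"
    unfolding N_def \<nu>_def by (intro suminf_le suminf_kth_mass_le) auto
  \<comment> \<open>The term \<open>k = 0\<close> belongs to time 0 and accounts for the leading 1
    of \<open>renewal_fun\<close>, whose \<open>k\<close>-th summand concerns \<open>Suc k\<close>
    ladder heights.\<close>
  also have "\<dots> = emeasure N {c. csum 0 c \<le> z} + (\<Sum>k. emeasure N {c. csum (Suc k) c \<le> z})"
    using suminf_offset[of "\<lambda>k. emeasure N {c. csum k c \<le> z}" 1] by (simp add: add.commute)
  also have "\<dots> \<le> 1 + (\<Sum>k. emeasure N {c. csum (Suc k) c \<le> z})"
    unfolding N_def by (intro add_right_mono N.P.emeasure_le_1)
  also have "\<dots> = renewal_fun M T z"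
    unfolding renewal_fun_def Let_def assms \<nu>_def[symmetric] N_def[symmetric]
    by (simp add: walk_def lessThan_Suc_atMost N_def)
  finally show ?thesis .
qed

end

lemma mono_renewal_fun: "mono (renewal_fun M T)"
proof (rule monoI)
  fix x y :: real assume "x \<le> y"
  define N where "N = Pi\<^sub>M UNIV (\<lambda>_::nat. distr M borel (ladder_height T))"
  have "emeasure N {c \<in> space N. (\<Sum>i\<le>k. c i) \<le> x} \<le> emeasure N {c \<in> space N. (\<Sum>i\<le>k. c i) \<le> y}" for k
  proof (rule emeasure_mono)
    have "(\<lambda>c. c i) \<in> borel_measurable N" for i
    proof -
      have "(\<lambda>c. c i) \<in> measurable N (distr M borel (ladder_height T))"
        unfolding N_def by (rule measurable_component_singleton) simp
      then show ?thesis by simp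
    qed
    note this [measurable]
    show "{c \<in> space N. (\<Sum>i\<le>k. c i) \<le> y} \<in> sets N" by measurable
  qed (use \<open>x \<le> y\<close> in auto)
  then show "renewal_fun M T x \<le> renewal_fun M T y"
    unfolding renewal_fun_def Let_def N_def[symmetric] by (intro add_left_mono suminf_le) auto
qed

section \<open>Survival above the boundary\<close>

lemma stays_above_iff_passage_time: "enat n < passage_time csum g x \<longleftrightarrow> stays_above g n x"
proof -
  define T where "T = {k. 1 \<le> k \<and> csum k x < - g (real k)}"
  have "enat n < Inf (enat ` T) \<longleftrightarrow> (\<forall>k\<in>T. n < k)"
  proof
    assume L: "enat n < Inf (enat ` T)"
    show "\<forall>k\<in>T. n < k"
    proof
      fix k assume "k \<in> T"
      then have "Inf (enat ` T) \<le> enat k" by (intro Inf_lower) simp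
      with L have "enat n < enat k" by (rule less_le_trans)
      then show "n < k" by simp
    qed
  next
    assume R: "\<forall>k\<in>T. n < k"
    have "enat (Suc n) \<le> Inf (enat ` T)" using R by (intro Inf_greatest) auto
    then show "enat n < Inf (enat ` T)" by (rule less_le_trans[rotated]) simp
  qed
  also have "(\<forall>k\<in>T. n < k) \<longleftrightarrow> stays_above g n x"
    unfolding T_def stays_above_def by (auto simp: not_le[symmetric])
  finally show ?thesis by (simp only: T_def passage_time_def)
qed

context iid_walk
begin

lemma tail_ratio:
  assumes lim: "(\<lambda>n. P.prob {x. 0 \<le> csum n x}) \<longlonglongrightarrow> \<rho>" and \<rho>: "0 < \<rho>" "\<rho> < 1"
  shows "0 < tail n" "(\<lambda>n. real n * tail n / (\<Sum>k<n. tail k)) \<longlonglongrightarrow> \<rho>"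
proof -
  \<comment> \<open>In \<open>spitzer_convolution\<close>, \<open>u n\<close> is the probability
    that \<open>n\<close> is a record, \<open>b n\<close> that of \<open>S_n \<ge> 0\<close> and
    \<open>c n\<close> that of \<open>S_n < 0\<close>.\<close>
  have rec: "real n * tail n = (\<Sum>k=1..n. P.prob {x. 0 \<le> csum k x} * tail (n - k))" for n
  proof (rule spitzer_convolution)
    fix n
    have "P.prob {x. True} = (\<Sum>j\<le>n. P.prob {x. is_record j x \<and> True} * tail (n - j))"
      by (rule last_record_decomposition) auto
    then show "(\<Sum>j\<le>n. P.prob {x. is_record j x} * tail (n - j)) = 1"
      using P.prob_space by simp
  next
    fix n :: nat assume n: "1 \<le> n"
    have "{x. csum n x < 0} = UNIV - {x. 0 \<le> csum n x}" by auto
    then show "P.prob {x. 0 \<le> csum n x} + P.prob {x. csum n x < 0} = 1"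
      using P.prob_compl[of "{x. 0 \<le> csum n x}"] by (simp add: sets_Collect_S)
    show "P.prob {x. csum n x < 0} =
        (\<Sum>i<n. \<Sum>k\<in>{i<..n}. (tail (k - 1) - tail k) * P.prob {x. is_record (n - k) x})"
      unfolding prob_csum_neg[OF n] by (intro sum.cong refl prob_record_nonneg) simp
  qed
  note * = convolution_ratio[OF rec tail_0 decseq_tail tail_nonneg _ _ lim \<rho>]
  show "0 < tail n" by (rule *(1)) auto
  show "(\<lambda>n. real n * tail n / (\<Sum>k<n. tail k)) \<longlonglongrightarrow> \<rho>" by (rule *(2)) auto
qed

text \<open>Equality, not just equivalence, because \<open>L\<close> interpolates
  \<open>tail n * n powr (1 - \<rho>)\<close> itself.\<close>

lemma tail_regularly_varying:
  assumes lim: "(\<lambda>n. P.prob {x. 0 \<le> csum n x}) \<longlonglongrightarrow> \<rho>" and \<rho>: "0 < \<rho>" "\<rho> < 1"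
  shows "\<exists>L. slowly_varying L \<and> (\<forall>n\<ge>1. tail n = real n powr (\<rho> - 1) * L (real n))"
proof (intro exI conjI allI impI)
  define l where "l n = tail n * real n powr (1 - \<rho>)" for n
  note tail = tail_ratio[OF lim \<rho>]
  show "slowly_varying (\<lambda>x. l (max 1 (nat \<lfloor>x\<rfloor>)))"
  proof (rule slowly_varying_interpolation)
    show "0 < l n" if "1 \<le> n" for n using that tail(1)[of n] by (simp add: l_def)
  qed (unfold l_def, rule regular_variation_of_ratio[OF tail(1) \<rho>(1) tail(2)])
  fix n :: nat assume "1 \<le> n"
  then have "real n powr (\<rho> - 1) * real n powr (1 - \<rho>) = 1"
    by (simp add: powr_add[symmetric])
  with \<open>1 \<le> n\<close> show "tail n = real n powr (\<rho> - 1) * l (max 1 (nat \<lfloor>real n\<rfloor>))"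
    by (simp add: l_def max_def mult.left_commute)
qed

text \<open>\<open>H\<close> stands for the renewal function, seen only through the properties
  assumed here. The limit obtained is the sum of the \<open>w j\<close>, the probabilities that
  \<open>j\<close> is a record with \<open>T_g > j\<close>.\<close>

lemma first_passage_asymptotics:
  fixes g :: "real \<Rightarrow> real" and H :: "real \<Rightarrow> ennreal"
  assumes lim: "(\<lambda>n. P.prob {x. 0 \<le> csum n x}) \<longlonglongrightarrow> \<rho>" and \<rho>: "0 < \<rho>" "\<rho> < 1"
    and g: "\<And>x. 0 \<le> x \<Longrightarrow> 0 \<le> g x" "mono_on {0..} g"
    and H: "mono H" "\<And>z. (\<Sum>j. emeasure S {x. is_record j x \<and> - csum j x \<le> z}) \<le> H z"
    and sub: "\<And>x. 0 \<le> x \<Longrightarrow> H (g (2 * x)) \<le> 2 * H (g x)"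
    and fin: "(\<integral>\<^sup>+x. (case ladder_epoch csum x of enat n \<Rightarrow> H (g (real n)) | \<infinity> \<Rightarrow> 0) \<partial>S) < \<infinity>"
  shows "\<exists>V>0. (\<lambda>n. P.prob {x. stays_above g n x} / tail n) \<longlonglongrightarrow> V"
proof -
  note tail = tail_ratio[OF lim \<rho>]
  define f where "f n = H (g (real n))" for n
  have f_mono: "f m \<le> f n" if "m \<le> n" for m n
    unfolding f_def using that by (intro monoD[OF H(1)] mono_onD[OF g(2)]) auto
  \<comment> \<open>\<open>B i\<close> is the event \<open>2^i < T_0 \<le> 2^(i+1)\<close>, on which
    \<open>f (2 ^ i)\<close> is a lower bound for the integrand in \<open>fin\<close>.\<close>
  define B where "B i = {x. nonneg (2 ^ i) x \<and> \<not> nonneg (2 ^ Suc i) x}" for i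
  have B [measurable]: "B i \<in> sets S" for i
    unfolding B_def by (rule sets_Collect_S) measurable
  have B_mono: "nonneg m x" if "nonneg n x" "m \<le> n" for m n x
    using that unfolding stays_above_def by auto
  have B_unique: "i = j" if "x \<in> B i" "x \<in> B j" for i j x
  proof -
    have "\<not> i < j" if "x \<in> B i" "x \<in> B j" for i j
    proof
      assume "i < j"
      then have "(2::nat) ^ Suc i \<le> 2 ^ j" by (intro power_increasing) auto
      with that B_mono[of "2 ^ j" x "2 ^ Suc i"] show False by (simp add: B_def)
    qed
    with that show ?thesis by (metis linorder_neqE_nat)
  qed
  define d where "d i = tail (2 ^ i) - tail (2 ^ Suc i)" for i
  have emB: "emeasure S (B i) = ennreal (d i)" for i
  proof -
    have "B i = {x. nonneg (2 ^ i) x} - {x. nonneg (2 ^ Suc i) x}" by (auto simp: B_def)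
    moreover have "{x. nonneg (2 ^ Suc i) x} \<subseteq> {x. nonneg (2 ^ i) x}"
      using B_mono[of "2 ^ Suc i" _ "2 ^ i"] by auto
    ultimately have "P.prob (B i) = d i"
      unfolding d_def tail_def by (simp add: P.finite_measure_Diff sets_Collect_S)
    then show ?thesis by (simp add: P.emeasure_eq_measure)
  qed
  have "(\<Sum>i. f (2 ^ i) * ennreal (d i)) = (\<Sum>i. \<integral>\<^sup>+x. f (2 ^ i) * indicator (B i) x \<partial>S)"
    by (simp add: nn_integral_cmult_indicator B emB)
  also have "\<dots> = (\<integral>\<^sup>+x. (\<Sum>i. f (2 ^ i) * indicator (B i) x) \<partial>S)"
    by (rule nn_integral_suminf[symmetric]) measurable
  also have "\<dots> \<le> (\<integral>\<^sup>+x. (case ladder_epoch csum x of enat n \<Rightarrow> f n | \<infinity> \<Rightarrow> 0) \<partial>S)"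
  proof (rule nn_integral_mono)
    fix x
    show "(\<Sum>i. f (2 ^ i) * indicator (B i) x) \<le> (case ladder_epoch csum x of enat n \<Rightarrow> f n | \<infinity> \<Rightarrow> 0)"
    proof (cases "\<exists>i. x \<in> B i")
      case True
      then obtain i where i: "x \<in> B i" by blast
      then have "\<not> nonneg (2 ^ Suc i) x" by (simp add: B_def)
      then obtain n where n: "first_record n x" by (rule ex_first_record)
      have "2 ^ i \<le> n"
      proof (rule ccontr)
        assume "\<not> 2 ^ i \<le> n"
        then have "n \<le> 2 ^ i" by simp
        then have "\<not> nonneg (2 ^ i) x" by (rule first_record_not_nonneg[OF n])
        with i show False by (simp add: B_def)
      qed
      have "x \<notin> B j" if "j \<noteq> i" for j using B_unique[of x i j] i that by auto
      then have "(\<Sum>j. f (2 ^ j) * indicator (B j) x) = (\<Sum>j\<in>{i}. f (2 ^ j) * indicator (B j) x)"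
        by (intro suminf_finite) auto
      also have "\<dots> \<le> f n" using i f_mono[OF \<open>2 ^ i \<le> n\<close>] by simp
      finally show ?thesis by (simp add: first_record_ladder_epoch[OF n])
    qed simp
  qed
  also have "\<dots> < \<infinity>" using fin unfolding f_def .
  finally have sum_fin: "(\<Sum>i. f (2 ^ i) * ennreal (d i)) < \<infinity>" .
  obtain \<theta> N where \<theta>: "0 < \<theta>" "\<theta> < 1" "\<And>n. N \<le> n \<Longrightarrow> tail (2 * n) \<le> \<theta> * tail n"
    using dyadic_decay[OF tail(1) \<rho> tail(2)] by blast
  have N2: "N \<le> 2 ^ i" if "N \<le> i" for i
    using that less_exp[of i] by linarith
  \<comment> \<open>The geometric decay replaces the increments \<open>d i\<close> of the tail by
    the tail itself in the convergent series \<open>sum_fin\<close>.\<close>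
  have d_ge: "(1 - \<theta>) * tail (2 ^ i) \<le> d i" if "N \<le> i" for i
    using \<theta>(3)[OF N2[OF that]] by (simp add: d_def algebra_simps)
  have d_pos: "0 < d i" if "N \<le> i" for i
  proof -
    have "0 < (1 - \<theta>) * tail (2 ^ i)" using \<theta>(2) tail(1)[of "2 ^ i"] by simp
    then show ?thesis using d_ge[OF that] by linarith
  qed
  have d0: "0 \<le> d i" for i unfolding d_def using decseqD[OF decseq_tail, of "2 ^ i" "2 ^ Suc i"] by simp
  \<comment> \<open>The finite sum has terms with positive weight \<open>d i\<close> at arbitrarily
    large \<open>2 ^ i\<close>, and \<open>f\<close> is increasing, so no value of \<open>f\<close>
    is infinite.\<close>
  have f_fin: "f n < \<infinity>" for n
  proof -
    define i where "i = max N n"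
    have "f (2 ^ i) * ennreal (d i) < \<infinity>"
    proof (rule le_less_trans[OF _ sum_fin])
      have "(\<Sum>j\<in>{i}. f (2 ^ j) * ennreal (d j)) \<le> (\<Sum>j. f (2 ^ j) * ennreal (d j))"
        by (rule sum_le_suminf) auto
      then show "f (2 ^ i) * ennreal (d i) \<le> (\<Sum>j. f (2 ^ j) * ennreal (d j))" by simp
    qed
    moreover have "ennreal (d i) \<noteq> 0" using d_pos[of i] by (simp add: i_def ennreal_eq_0_iff)
    ultimately have "f (2 ^ i) < \<infinity>"
      unfolding infinity_ennreal_def ennreal_mult_less_top by auto
    moreover have "n \<le> 2 ^ i"
      by (rule order_trans[OF _ less_imp_le[OF less_exp]]) (simp add: i_def)
    ultimately show ?thesis by (rule le_less_trans[OF f_mono, rotated])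
  qed
  \<comment> \<open>Records in \<open>(n, 2 n]\<close> that respect the boundary have depth at most
    \<open>g (2 n)\<close>, hence the argument \<open>2 * n\<close>. The assumption
    \<open>sub\<close> brings it back to \<open>n\<close> in \<open>sumF\<close>.\<close>
  define F where "F n = enn2real (f (2 * n))" for n
  have F: "ennreal (F n) = f (2 * n)" for n
    using f_fin[of "2 * n"] by (simp add: F_def)
  have F0: "0 \<le> F n" for n by (simp add: F_def)
  have sumF: "summable (\<lambda>i. tail (2 ^ i) * F (2 ^ i))"
  proof -
    have "summable (\<lambda>i. enn2real (f (2 ^ i)) * d i)"
    proof (rule summable_suminf_not_top)
      have "ennreal (enn2real (f (2 ^ i)) * d i) = f (2 ^ i) * ennreal (d i)" for i
        using f_fin[of "2 ^ i"] d0[of i] by (simp add: ennreal_mult)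
      then show "(\<Sum>i. ennreal (enn2real (f (2 ^ i)) * d i)) \<noteq> top" using sum_fin by simp
    qed (simp add: d0)
    then have "summable (\<lambda>i. 2 / (1 - \<theta>) * (enn2real (f (2 ^ i)) * d i))" by (rule summable_mult)
    then show ?thesis
    proof (rule summable_comparison_test'[where N = N])
      fix i assume i: "N \<le> i"
      have "ennreal (F (2 ^ i)) \<le> ennreal (2 * enn2real (f (2 ^ i)))"
        using sub[of "real (2 ^ i)"] f_fin[of "2 ^ i"] unfolding F
        by (simp add: f_def ennreal_mult)
      then have "F (2 ^ i) \<le> 2 * enn2real (f (2 ^ i))" by (simp add: ennreal_le_iff)
      moreover have "tail (2 ^ i) \<le> d i / (1 - \<theta>)" using d_ge[OF i] \<theta>(2) by (simp add: field_simps)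
      ultimately have "tail (2 ^ i) * F (2 ^ i) \<le> d i / (1 - \<theta>) * (2 * enn2real (f (2 ^ i)))"
        using d0[of i] \<theta>(2) F0 by (intro mult_mono) auto
      then show "norm (tail (2 ^ i) * F (2 ^ i)) \<le> 2 / (1 - \<theta>) * (enn2real (f (2 ^ i)) * d i)"
        using F0[of "2 ^ i"] tail_nonneg[of "2 ^ i"] by (simp add: ac_simps)
    qed
  qed
  define w where "w j = P.prob {x. is_record j x \<and> stays_above g j x}" for j
  define p where "p n = P.prob {x. stays_above g n x}" for n
  have p: "p n = (\<Sum>j\<le>n. w j * tail (n - j))" for n
    unfolding p_def w_def
  proof (rule last_record_decomposition)
    show "stays_above g n x \<longleftrightarrow> stays_above g j x" if "j \<le> n" "nonneg (n - j) (seq_shift j x)" for j x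
      by (rule stays_above_last_record[OF g(2,1) that])
  qed (simp_all add: stays_above_comb_seq)
  have p_dec: "decseq p" unfolding p_def by (rule decseq_prob_stays_above)
  have w0: "0 \<le> w j" for j by (simp add: w_def)
  have wF: "(\<Sum>j\<in>{n<..2 * n}. w j) \<le> p n * F n" for n
  proof -
    have "(\<Sum>j\<in>{n<..2 * n}. w j) \<le>
        (\<Sum>j\<in>{n<..2 * n}. P.prob {x. stays_above g n x \<and> is_record j x \<and> - csum j x \<le> g (real (2 * n))})"
    proof (rule sum_mono)
      fix j assume j: "j \<in> {n<..2 * n}"
      have gj: "g (real j) \<le> g (real (2 * n))" using j by (intro mono_onD[OF g(2)]) auto
      have "- csum j x \<le> g (real (2 * n))" if "stays_above g j x" for x
      proof -
        have "- g (real j) \<le> csum j x" using that j unfolding stays_above_def by auto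
        with gj show ?thesis by linarith
      qed
      moreover have "stays_above g n x" if "stays_above g j x" for x using that j by (auto simp: stays_above_def)
      ultimately show "w j \<le> P.prob {x. stays_above g n x \<and> is_record j x \<and> - csum j x \<le> g (real (2 * n))}"
        unfolding w_def by (intro P.finite_measure_mono) (auto intro!: sets_Collect_S)
    qed
    also have "\<dots> \<le> P.prob {x. stays_above g n x} * F n"
    proof (rule sum_records_after_le)
      fix M
      have "ennreal (\<Sum>m\<le>M. P.prob {x. is_record m x \<and> - csum m x \<le> g (real (2 * n))}) =
          (\<Sum>m\<le>M. emeasure S {x. is_record m x \<and> - csum m x \<le> g (real (2 * n))})"
        by (simp add: P.emeasure_eq_measure)
      also have "\<dots> \<le> (\<Sum>m. emeasure S {x. is_record m x \<and> - csum m x \<le> g (real (2 * n))})"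
        by (rule sum_le_suminf) auto
      also have "\<dots> \<le> H (g (real (2 * n)))" by (rule H(2))
      also have "\<dots> = ennreal (F n)" by (simp only: F f_def)
      finally show "(\<Sum>m\<le>M. P.prob {x. is_record m x \<and> - csum m x \<le> g (real (2 * n))}) \<le> F n"
        using F0 by (simp add: ennreal_le_iff)
    qed (auto simp: stays_above_comb_seq)
    finally show ?thesis by (simp only: p_def)
  qed
  have sw: "summable w"
    by (rule summable_of_dyadic_growth[OF p p_dec w0 tail(1) \<rho>(1) tail(2) F0 wF sumF])
  \<comment> \<open>Time 0 is a record on which the boundary imposes nothing; this term makes the
    limit positive.\<close>
  have "w 0 = 1" using P.prob_space by (simp add: w_def is_record_def stays_above_def)
  then have "0 < suminf w" using suminf_pos2[OF sw w0, of 0] by simp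
  moreover have "(\<lambda>n. p n / tail n) \<longlonglongrightarrow> suminf w"
    by (rule convolution_asymptotics[OF p p_dec w0 sw tail(1) decseq_tail \<rho>(1) tail(2)])
  ultimately show ?thesis unfolding p_def by blast
qed

end

lemma ratio_tendsto_imp_asymp_equiv:
  fixes f h :: "nat \<Rightarrow> real"
  assumes "V > 0" "\<And>n. 0 < h n" "(\<lambda>n. f n / h n) \<longlonglongrightarrow> V"
  shows "f \<sim>[sequentially] (\<lambda>n. V * h n)"
proof (rule asymp_equivI')
  have "(\<lambda>n. f n / h n / V) \<longlonglongrightarrow> V / V" by (intro tendsto_intros assms) (use assms in auto)
  then show "(\<lambda>n. f n / (V * h n)) \<longlonglongrightarrow> 1" using assms(1) by (simp add: mult.commute)
qed

theorem theorem1: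
  fixes M :: "'a measure" and X :: "nat \<Rightarrow> 'a \<Rightarrow> real"
    and g :: "real \<Rightarrow> real" and \<rho> :: real
  defines "S \<equiv> walk X"
  defines "h \<equiv> renewal_fun M S"
  assumes "prob_space M"
    and "prob_space.indep_vars M (\<lambda>_. borel) X UNIV"
    and "\<And>i. distr M borel (X i) = distr M borel (X 0)"
    and "0 < \<rho>" "\<rho> < 1"
    and "(\<lambda>n. measure M {\<omega> \<in> space M. S n \<omega> \<ge> 0}) \<longlonglongrightarrow> \<rho>"
    and "\<And>x. x \<ge> 0 \<Longrightarrow> g x > 0"
    and "mono_on {0..} g"
    and "\<And>x y. x \<ge> 0 \<Longrightarrow> y \<ge> 0 \<Longrightarrow> h (g (x + y)) \<le> h (g x) + h (g y)"
    and "(\<integral>\<^sup>+\<omega>. (case ladder_epoch S \<omega> of enat n \<Rightarrow> h (g (real n)) | \<infinity> \<Rightarrow> 0) \<partial>M) < \<infinity>"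
  shows "\<exists>V>0. \<exists>L. slowly_varying L \<and>
    (\<lambda>n. measure M {\<omega> \<in> space M. ladder_epoch S \<omega> > enat n})
      \<sim>[sequentially] (\<lambda>n. real n powr (\<rho> - 1) * L (real n)) \<and>
    (\<lambda>n. measure M {\<omega> \<in> space M. passage_time S g \<omega> > enat n})
      \<sim>[sequentially] (\<lambda>n. V * measure M {\<omega> \<in> space M. ladder_epoch S \<omega> > enat n}) \<and>
    (\<lambda>n. V * measure M {\<omega> \<in> space M. ladder_epoch S \<omega> > enat n})
      \<sim>[sequentially] (\<lambda>n. V * (real n powr (\<rho> - 1) * L (real n)))"
proof -
  interpret M: prob_space M by fact
  define \<mu> where "\<mu> = distr M borel (X 0)"
  have X [measurable]: "X i \<in> borel_measurable M" for i
    using assms(4) unfolding M.indep_vars_def2 by auto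
  interpret mu: prob_space \<mu> unfolding \<mu>_def by (rule M.prob_space_distr) measurable
  interpret W: iid_walk \<mu> by unfold_locales (simp add: \<mu>_def)
  define \<Phi> where "\<Phi> \<omega> = (\<lambda>i. X i \<omega>)" for \<omega>
  have sets_S: "sets W.S = sets (Pi\<^sub>M UNIV (\<lambda>_::nat. borel))"
    by (intro sets_PiM_cong refl W.sets_mu)
  have \<Phi> [measurable]: "\<Phi> \<in> measurable M W.S"
    unfolding \<Phi>_def measurable_cong_sets[OF refl sets_S]
    by (rule measurable_PiM_single') auto
  \<comment> \<open>Independence together with equal marginals says that the sequence of increments
    has the product law, so every probability can be computed on the canonical space.\<close>
  have law: "distr M W.S \<Phi> = W.S"
  proof -
    have "distr M (Pi\<^sub>M UNIV (\<lambda>_. borel)) (\<lambda>\<omega>. \<lambda>i\<in>UNIV. X i \<omega>) = Pi\<^sub>M UNIV (\<lambda>i. distr M borel (X i))"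
      using M.indep_vars_iff_distr_eq_PiM[where I = UNIV and M' = "\<lambda>_. borel" and X = X] assms(4) by simp
    moreover have "Pi\<^sub>M UNIV (\<lambda>i. distr M borel (X i)) = W.S"
      unfolding \<mu>_def by (intro PiM_cong refl assms(5))
    moreover have "distr M W.S \<Phi> = distr M (Pi\<^sub>M UNIV (\<lambda>_. borel)) (\<lambda>\<omega>. \<lambda>i\<in>UNIV. X i \<omega>)"
      by (rule distr_cong) (simp_all add: sets_S \<Phi>_def restrict_def)
    ultimately show ?thesis by simp
  qed
  have transfer: "measure M {\<omega> \<in> space M. Q (\<Phi> \<omega>)} = W.P.prob {x. Q x}"
    if "Measurable.pred W.S Q" for Q
  proof -
    have "W.P.prob {x. Q x} = measure (distr M W.S \<Phi>) {x. Q x}" by (simp only: law)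
    also have "\<dots> = measure M (\<Phi> -` {x. Q x} \<inter> space M)"
      by (rule measure_distr[OF \<Phi> W.sets_Collect_S[OF that]])
    also have "\<Phi> -` {x. Q x} \<inter> space M = {\<omega> \<in> space M. Q (\<Phi> \<omega>)}" by auto
    finally show ?thesis by simp
  qed
  have S: "S n \<omega> = csum n (\<Phi> \<omega>)" for n \<omega>
    by (simp add: S_def walk_def \<Phi>_def)
  have passage: "passage_time S b \<omega> = passage_time csum b (\<Phi> \<omega>)" for b \<omega>
    unfolding passage_time_def S ..
  have height: "ladder_height S \<omega> = ladder_height csum (\<Phi> \<omega>)" for \<omega>
    unfolding ladder_height_def passage S ..
  have survive: "measure M {\<omega> \<in> space M. passage_time S b \<omega> > enat n} = W.P.prob {x. stays_above b n x}" for b n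
    unfolding passage stays_above_iff_passage_time by (rule transfer) measurable
  have epoch: "measure M {\<omega> \<in> space M. ladder_epoch S \<omega> > enat n} = W.tail n" for n
    unfolding survive W.tail_def ..
  have lim: "(\<lambda>n. W.P.prob {x. 0 \<le> csum n x}) \<longlonglongrightarrow> \<rho>"
  proof -
    have "measure M {\<omega> \<in> space M. S n \<omega> \<ge> 0} = W.P.prob {x. 0 \<le> csum n x}" for n
      unfolding S by (rule transfer) measurable
    with assms(8) show ?thesis by simp
  qed
  \<comment> \<open>\<open>renewal_fun\<close> sees the walk only through the law of its ladder
    height, so \<open>h\<close> is the same for \<open>S\<close> and for the coordinate
    walk.\<close>
  have law_height: "distr M borel (ladder_height S) = distr W.S borel (ladder_height csum)"
  proof -
    have "distr W.S borel (ladder_height csum) = distr (distr M W.S \<Phi>) borel (ladder_height csum)"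
      by (simp only: law)
    also have "\<dots> = distr M borel (ladder_height csum \<circ> \<Phi>)"
      by (rule distr_distr) measurable
    also have "ladder_height csum \<circ> \<Phi> = ladder_height S"
      by (rule ext) (simp add: height)
    finally show ?thesis by simp
  qed
  have fin: "(\<integral>\<^sup>+x. (case ladder_epoch csum x of enat n \<Rightarrow> h (g (real n)) | \<infinity> \<Rightarrow> 0) \<partial>W.S) < \<infinity>"
  proof -
    have meas: "(\<lambda>x. case ladder_epoch csum x of enat n \<Rightarrow> h (g (real n)) | \<infinity> \<Rightarrow> 0) \<in> borel_measurable W.S"
    proof -
      have "(\<lambda>x. ladder_epoch csum x) \<in> measurable W.S (count_space UNIV)"
        by (rule W.measurable_ladder_epoch)
      then show ?thesis by (rule measurable_compose) simp
    qed
    have "(\<integral>\<^sup>+x. (case ladder_epoch csum x of enat n \<Rightarrow> h (g (real n)) | \<infinity> \<Rightarrow> 0) \<partial>W.S) =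
        (\<integral>\<^sup>+x. (case ladder_epoch csum x of enat n \<Rightarrow> h (g (real n)) | \<infinity> \<Rightarrow> 0) \<partial>distr M W.S \<Phi>)"
      by (simp only: law)
    also have "\<dots> = (\<integral>\<^sup>+\<omega>. (case ladder_epoch S \<omega> of enat n \<Rightarrow> h (g (real n)) | \<infinity> \<Rightarrow> 0) \<partial>M)"
      unfolding passage by (rule nn_integral_distr) (use meas in simp_all)
    finally show ?thesis using assms(12) by simp
  qed
  have renewal: "(\<Sum>j. emeasure W.S {x. is_record j x \<and> - csum j x \<le> z}) \<le> h z" for z
    using W.suminf_record_le_renewal[OF law_height, of z] unfolding h_def .
  have mono_h: "mono h" unfolding h_def by (rule mono_renewal_fun)
  have sub: "h (g (2 * x)) \<le> 2 * h (g x)" if "0 \<le> x" for x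
    using assms(11)[OF that that] by (simp only: mult_2)
  have g_nonneg: "0 \<le> g x" if "0 \<le> x" for x
    using assms(9)[OF that] by simp
  obtain V where V: "V > 0" "(\<lambda>n. W.P.prob {x. stays_above g n x} / W.tail n) \<longlonglongrightarrow> V"
    using W.first_passage_asymptotics[where g = g and H = h,
        OF lim assms(6,7) g_nonneg assms(10) mono_h renewal sub fin] by blast
  obtain L where L: "slowly_varying L" "\<And>n. 1 \<le> n \<Longrightarrow> W.tail n = real n powr (\<rho> - 1) * L (real n)"
    using W.tail_regularly_varying[OF lim assms(6,7)] by blast
  \<comment> \<open>The equality starts at 1: at \<open>n = 0\<close> the right-hand side is 0
    because \<open>0 powr _ = 0\<close>, while \<open>W.tail 0 = 1\<close>.\<close>
  have 1: "W.tail \<sim>[sequentially] (\<lambda>n. real n powr (\<rho> - 1) * L (real n))"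
    by (rule asymp_equiv_refl_ev) (use L in \<open>auto intro: eventually_sequentiallyI[of 1]\<close>)
  have 2: "(\<lambda>n. W.P.prob {x. stays_above g n x}) \<sim>[sequentially] (\<lambda>n. V * W.tail n)"
    by (rule ratio_tendsto_imp_asymp_equiv[OF V(1) W.tail_ratio(1)[OF lim assms(6,7)] V(2)])
  have 3: "(\<lambda>n. V * W.tail n) \<sim>[sequentially] (\<lambda>n. V * (real n powr (\<rho> - 1) * L (real n)))"
    by (intro asymp_equiv_mult asymp_equiv_refl 1)
  show ?thesis unfolding epoch survive using V(1) L(1) 1 2 3 by blast
qed

end
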